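(* Let $G$ be a finite graph cellularly embedded in a compact, connected, orientable, boundaryless surface $\Sigma$, with dual graph $G^*$ and positive constants $(J_{e^*})_{e^*\in E^*}$. Let the edges of $G^Q$ be weighted as follows: weight $1$ for external edges, $a_e=\frac{2e^{-2J_{e^*}}}{1+e^{-4J_{e^*}}}$ for internal edges parallel to $e\in E$, and $b_{e^*}=\frac{1-e^{-4J_{e^*}}}{1+e^{-4J_{e^*}}}$ for internal edges parallel to $e^*\in E^*$. Then for all $(P,P^* )\in\mathcal P^0(G)\times\mathcal P^0(G^* )$ such that $P\cap P^*=\emptyset$, $$W_{\mathrm{quadri}}[\mathrm{Poly}=(P,P^* )]=2\Bigl(\prod_{e\in P}\frac{2e^{-2J_{e^*}}}{1+e^{-4J_{e^*}}}\Bigr)\Bigl(\prod_{e^*\in P^*}\frac{1-e^{-4J_{e^*}}}{1+e^{-4J_{e^*}}}\Bigr).$$ Moreover, $$Z^0_{\mathrm{quadri}}(G^Q,J)=2\sum_{\substack{(P,P^* )\in\mathcal P^0(G)\times\mathcal P^0(G^* )\\P\cap P^*=\emptyset}}\Bigl(\prod_{e\in P}\frac{2e^{-2J_{e^*}}}{1+e^{-4J_{e^*}}}\Bigr)\Bigl(\prod_{e^*\in P^*}\frac{1-e^{-4J_{e^*}}}{1+e^{-4J_{e^*}}}\Bigr),$$ and $\mathbb P^0_{\mathrm{quadri}}$ induces a probability measure on polygon configurations of $\mathcal P^0(G)$ given, for $P\in\mathcal P^0(G)$, by $$\mathbb P^0_{\mathrm{quadri}}[\mathrm{Poly}_1=P]=\frac{\Bigl(\prod_{e\in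 P}\frac{2e^{-2J_{e^*}}}{1+e^{-4J_{e^*}}}\Bigr)\sum\limits_{\{P^*\in\mathcal P^0(G^* ):\,P\cap P^*=\emptyset\}}\Bigl(\prod_{e^*\in P^*}\frac{1-e^{-4J_{e^*}}}{1+e^{-4J_{e^*}}}\Bigr)}{\sum\limits_{\substack{(Q,Q^* )\in\mathcal P^0(G)\times\mathcal P^0(G^* )\\Q\cap Q^*=\emptyset}}\Bigl(\prod_{e\in Q}\frac{2e^{-2J_{e^*}}}{1+e^{-4J_{e^*}}}\Bigr)\Bigl(\prod_{e^*\in Q^*}\frac{1-e^{-4J_{e^*}}}{1+e^{-4J_{e^*}}}\Bigr)}.$$
   Context: $G=(V,E)$, $G^*=(V^*,E^* )$, $e\mapsto e^*$ the bijection between edges and dual edges. A polygon configuration of $G$ (resp. $G^*$) is a subset of edges with even degree at every vertex; $\mathcal P^0(G)$ (resp. $\mathcal P^0(G^* )$) is the set of those with zero class in $H_1(\Sigma;\mathbb Z/2\mathbb Z)$. $P\cap P^*=\emptyset$ means there is no $e\in P$ with $e^*\in P^*$. Medial graph $G^M$: it has one (4-valent) vertex $v(e)$ per edge $e$ of $G$, and two medial vertices are joined by an edge through each corner of a face at which the corresponding edges of $G$ are consecutive. The four medial edges at $v(e)$ lie in the four sectors delimited by $e$ and $e^*$. Quadri-tiling graph $G^Q$: it is obtained from $G^M$ by replacing each vertex $v(e)$ by a quadrangle (4-cycle) whose four corners are attached, in cyclic order, to the four medial edges at $v(e)$. Edges coming from $G^M$ are external, edges of quadrangles are internal. In the quadrangle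 of $v(e)$, two internal edges are parallel to $e$ (each joins two corners on the same side of $e$) and two are parallel to $e^*$ (each joins two corners on the same side of $e^*$). A dimer configuration is a perfect matching of $G^Q$; its weight is the product of its edge weights. Map $\mathrm{Poly}$: given a dimer configuration $M$, its external edges form an edge configuration of $G^M$ such that around each vertex of $G^M$ none, all, or exactly two consecutive edges are present. For each $e$ such that exactly two medial edges at $v(e)$ are present, select whichever of $e,e^*$ separates the two present from the two absent ones. $\mathrm{Poly}_1(M)\subset E$ and $\mathrm{Poly}_2(M)\subset E^*$ are the sets of selected primal and dual edges, and $\mathrm{Poly}(M)=(\mathrm{Poly}_1(M),\mathrm{Poly}_2(M))$. $\mathcal M^0(G^Q)$ is the set of dimer configurations $M$ with $\mathrm{Poly}_1(M)$ of zero class in $H_1(\Sigma;\mathbb Z/2\mathbb Z)$. $Z^0_{\mathrm{quadri}}(G^Q,J)$ is the sum of weights over $\mathcal M^0(G^Q)$, and $\mathbb P^0_{\mathrm{quadri}}$ is the probability measure on $\mathcal M^0(G^Q)$ proportional to the weight. $W_{\mathrm{quadri}}[\mathrm{Poly}=(P,P^* )]$ is the sum of weights of dimer configurations $M$ with $\mathrm{Poly}(M)=(P,P^* )$.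
   Formalization: G is assumed to have at least one edge: for the one-vertex graph without edges on the sphere, G^Q is empty, its only dimer configuration has weight 1, and the stated factor 2 fails. *)

theory Defs
  imports
    "Graph_Theory.Graph_Theory"
    "HOL-Combinatorics.Orbits"
    "HOL-Algebra.Coset"
    "HOL-Probability.Probability"
begin

section \<open>Cellularly embedded graphs\<close>

text \<open>
  A finite graph (loops and multiple edges allowed) is a bidirected digraph in which every edge
  is a pair of opposite arcs. By the Heffter--Edmonds theorem, its cellular embeddings in closed
  connected oriented surfaces are the rotation systems: \<open>edge_succ\<close> sends an arc to
  the next arc, counterclockwise, with the same tail. The one-vertex graph without edges in the
  sphere is the only embedding that is not described correctly: its face has no arc on its boundary.
\<close>

record 'a rotation =
  edge_rev :: "'a \<Rightarrow> 'a"
  edge_succ :: "'a \<Rightarrow> 'a"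

locale cellular_embedding = fin_digraph G + bidirected_digraph G "edge_rev M"
  for G :: "('v, 'a) pre_digraph" and M :: "'a rotation" +
  assumes connected_graph: "Digraph_Component.connected G"
    and succ_permutes: "edge_succ M permutes arcs G"
    and succ_cyclic: "\<And>v. \<lbrakk>v \<in> verts G; out_arcs G v \<noteq> {}\<rbrakk> \<Longrightarrow>
          cyclic_on (edge_succ M) (out_arcs G v)"

definition arc_edge :: "'a rotation \<Rightarrow> 'a \<Rightarrow> 'a set" where
  "arc_edge M a = {a, edge_rev M a}"

definition edges :: "('v, 'a) pre_digraph \<Rightarrow> 'a rotation \<Rightarrow> 'a set set" where
  "edges G M = arc_edge M ` arcs G"

text \<open>
  The face to the left of an arc is the orbit of the arc under \<open>face_succ\<close>,
  which walks along the boundary of that face, keeping it on the left.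
\<close>

definition face_succ :: "'a rotation \<Rightarrow> 'a \<Rightarrow> 'a" where
  "face_succ M = inv_into UNIV (edge_succ M) \<circ> edge_rev M"

definition left_face :: "'a rotation \<Rightarrow> 'a \<Rightarrow> 'a set" where
  "left_face M a = orbit (face_succ M) a"

definition faces :: "('v, 'a) pre_digraph \<Rightarrow> 'a rotation \<Rightarrow> 'a set set" where
  "faces G M = left_face M ` arcs G"

text \<open>
  The dual arc crossing \<open>a\<close> from left to right is again called \<open>a\<close>. Hence the dual
  edge of \<open>e\<close> is the same set of two arcs as \<open>e\<close>, read as an edge of the dual graph.
\<close>

definition dual_graph :: "('v, 'a) pre_digraph \<Rightarrow> 'a rotation \<Rightarrow> ('a set, 'a) pre_digraph" where
  "dual_graph G M = \<lparr>verts = faces G M, arcs = arcs G,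
     tail = left_face M, head = (\<lambda>a. left_face M (edge_rev M a))\<rparr>"

definition dual_rotation :: "'a rotation \<Rightarrow> 'a rotation" where
  "dual_rotation M = \<lparr>edge_rev = edge_rev M, edge_succ = face_succ M\<rparr>"

section \<open>Polygon configurations and homology modulo 2\<close>

text \<open>Loops contribute 2 to the degree, since both of their arcs leave the vertex.\<close>

definition degree_in :: "('v, 'a) pre_digraph \<Rightarrow> 'a rotation \<Rightarrow> 'a set set \<Rightarrow> 'v \<Rightarrow> nat" where
  "degree_in G M P v = card {a \<in> out_arcs G v. arc_edge M a \<in> P}"

definition polygon_configs :: "('v, 'a) pre_digraph \<Rightarrow> 'a rotation \<Rightarrow> 'a set set set" where
  "polygon_configs G M = {P. P \<subseteq> edges G M \<and> (\<forall>v\<in>verts G. even (degree_in G M P v))}"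

text \<open>
  Cellular homology with coefficients modulo 2: a chain is identified with its support, so
  addition of chains is symmetric difference, and the cycles are the polygon configurations.
\<close>

definition cycle_group :: "('v, 'a) pre_digraph \<Rightarrow> 'a rotation \<Rightarrow> 'a set set monoid" where
  "cycle_group G M = \<lparr>carrier = polygon_configs G M,
     mult = sym_diff, one = {}\<rparr>"

definition face_boundary :: "('v, 'a) pre_digraph \<Rightarrow> 'a rotation \<Rightarrow> 'a set set \<Rightarrow> 'a set set" where
  "face_boundary G M F = {e \<in> edges G M. odd (card {a \<in> e. left_face M a \<in> F})}"

definition boundaries :: "('v, 'a) pre_digraph \<Rightarrow> 'a rotation \<Rightarrow> 'a set set set" where
  "boundaries G M = face_boundary G M ` Pow (faces G M)"

definition H1 :: "('v, 'a) pre_digraph \<Rightarrow> 'a rotation \<Rightarrow> 'a set set set monoid" where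
  "H1 G M = cycle_group G M Mod boundaries G M"

definition homology_class ::
    "('v, 'a) pre_digraph \<Rightarrow> 'a rotation \<Rightarrow> 'a set set \<Rightarrow> 'a set set set" where
  "homology_class G M P = boundaries G M #>\<^bsub>cycle_group G M\<^esub> P"

definition polygon_configs0 :: "('v, 'a) pre_digraph \<Rightarrow> 'a rotation \<Rightarrow> 'a set set set" where
  "polygon_configs0 G M = {P \<in> polygon_configs G M. homology_class G M P = \<one>\<^bsub>H1 G M\<^esub>}"

definition polygon_pairs0 ::
    "('v, 'a) pre_digraph \<Rightarrow> 'a rotation \<Rightarrow> ('a set set \<times> 'a set set) set" where
  "polygon_pairs0 G M =
     {(P, Q). P \<in> polygon_configs0 G M \<and>
              Q \<in> polygon_configs0 (dual_graph G M) (dual_rotation M) \<and> P \<inter> Q = {}}"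

section \<open>The quadri-tiling graph\<close>

text \<open>
  The four sectors at the crossing of an edge and its dual are labelled by an arc \<open>a\<close> of the
  edge and a side: the sector touching the tail half of \<open>a\<close>, to the left or to the right of
  \<open>a\<close>. In counterclockwise order, the sectors at an edge
  \<open>{a, b}\<close> are \<open>(a, Lft), (a, Rgt), (b, Lft), (b, Rgt)\<close>. They are the corners of the quadrangle, and so the
  vertices of the quadri-tiling graph.

  \<open>External a\<close> is the medial edge through the face corner between \<open>a\<close> and
  \<open>edge_succ M a\<close>. \<open>ParPrimal a\<close> is the internal edge on the left of \<open>a\<close>, parallel to the
  edge of \<open>a\<close>. \<open>ParDual a\<close> is the internal edge crossing the tail half of \<open>a\<close>,
  parallel to the dual edge. Edges are named rather than given by their endpoints because the
  quadri-tiling graph can have multiple edges.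
\<close>

datatype side = Lft | Rgt

type_synonym 'a corner = "'a \<times> side"

datatype 'a qedge = External 'a | ParPrimal 'a | ParDual 'a

definition qverts :: "('v, 'a) pre_digraph \<Rightarrow> 'a corner set" where
  "qverts G = arcs G \<times> UNIV"

definition qedges :: "('v, 'a) pre_digraph \<Rightarrow> 'a qedge set" where
  "qedges G = External ` arcs G \<union> ParPrimal ` arcs G \<union> ParDual ` arcs G"

fun qends :: "'a rotation \<Rightarrow> 'a qedge \<Rightarrow> 'a corner set" where
  "qends M (External a) = {(a, Lft), (edge_succ M a, Rgt)}"
| "qends M (ParPrimal a) = {(a, Lft), (edge_rev M a, Rgt)}"
| "qends M (ParDual a) = {(a, Lft), (a, Rgt)}"

definition dimers :: "('v, 'a) pre_digraph \<Rightarrow> 'a rotation \<Rightarrow> 'a qedge set set" where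
  "dimers G M = {D. D \<subseteq> qedges G \<and> (\<forall>c\<in>qverts G. \<exists>!x. x \<in> D \<and> c \<in> qends M x)}"

fun qweight :: "'a rotation \<Rightarrow> ('a set \<Rightarrow> real) \<Rightarrow> 'a qedge \<Rightarrow> real" where
  "qweight M J (External a) = 1"
| "qweight M J (ParPrimal a) =
     2 * exp (- 2 * J (arc_edge M a)) / (1 + exp (- 4 * J (arc_edge M a)))"
| "qweight M J (ParDual a) =
     (1 - exp (- 4 * J (arc_edge M a))) / (1 + exp (- 4 * J (arc_edge M a)))"

definition dimer_weight :: "'a rotation \<Rightarrow> ('a set \<Rightarrow> real) \<Rightarrow> 'a qedge set \<Rightarrow> real" where
  "dimer_weight M J D = (\<Prod>x\<in>D. qweight M J x)"

text \<open>
  The medial edges present around \<open>e\<close> are recorded by their sectors, because a medial edge can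
  have both of its ends at \<open>e\<close>. Two sectors separated from the other two by \<open>e\<close>
  lie on one side of \<open>e\<close>, and likewise for the dual edge.
\<close>

definition present_sectors :: "'a rotation \<Rightarrow> 'a qedge set \<Rightarrow> 'a set \<Rightarrow> 'a corner set" where
  "present_sectors M D e = {c \<in> e \<times> UNIV. \<exists>a. External a \<in> D \<and> c \<in> qends M (External a)}"

definition Poly1 :: "('v, 'a) pre_digraph \<Rightarrow> 'a rotation \<Rightarrow> 'a qedge set \<Rightarrow> 'a set set" where
  "Poly1 G M D =
     {e \<in> edges G M. \<exists>a\<in>e. present_sectors M D e = {(a, Lft), (edge_rev M a, Rgt)}}"

definition Poly2 :: "('v, 'a) pre_digraph \<Rightarrow> 'a rotation \<Rightarrow> 'a qedge set \<Rightarrow> 'a set set" where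
  "Poly2 G M D =
     {e \<in> edges (dual_graph G M) (dual_rotation M).
        \<exists>a\<in>e. present_sectors M D e = {(a, Lft), (a, Rgt)}}"

definition Poly ::
    "('v, 'a) pre_digraph \<Rightarrow> 'a rotation \<Rightarrow> 'a qedge set \<Rightarrow> 'a set set \<times> 'a set set" where
  "Poly G M D = (Poly1 G M D, Poly2 G M D)"

section \<open>Partition functions and the dimer measure\<close>

definition W_quadri ::
    "('v, 'a) pre_digraph \<Rightarrow> 'a rotation \<Rightarrow> ('a set \<Rightarrow> real) \<Rightarrow> 'a set set \<times> 'a set set \<Rightarrow> real"
  where
  "W_quadri G M J PQ = (\<Sum>D\<in>{D \<in> dimers G M. Poly G M D = PQ}. dimer_weight M J D)"

definition dimers0 :: "('v, 'a) pre_digraph \<Rightarrow> 'a rotation \<Rightarrow> 'a qedge set set" where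
  "dimers0 G M = {D \<in> dimers G M. Poly1 G M D \<in> polygon_configs0 G M}"

definition Z0_quadri ::
    "('v, 'a) pre_digraph \<Rightarrow> 'a rotation \<Rightarrow> ('a set \<Rightarrow> real) \<Rightarrow> real" where
  "Z0_quadri G M J = (\<Sum>D\<in>dimers0 G M. dimer_weight M J D)"

definition P0_quadri ::
    "('v, 'a) pre_digraph \<Rightarrow> 'a rotation \<Rightarrow> ('a set \<Rightarrow> real) \<Rightarrow> 'a qedge set measure" where
  "P0_quadri G M J =
     point_measure (dimers0 G M) (\<lambda>D. ennreal (dimer_weight M J D / Z0_quadri G M J))"

end

theory Submission
  imports Defs
begin

text \<open>
  Label every arc \<open>a\<close> by whether the external edge in the corner between \<open>a\<close> and its successor
  is present, and let \<open>X\<close> be the set of arcs labelled true. The four sectors at the crossing of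
  an edge with its dual then carry four truth values. The missing part of a dimer
  configuration there is a perfect matching of the corners of the quadrangle that \<open>X\<close> leaves
  free, and such a matching exists exactly when none, all or two neighbouring sectors are
  present. So the edge lies in \<open>Poly1\<close> iff \<open>X\<close> changes across it, and in \<open>Poly2\<close> iff \<open>X\<close> changes
  across its dual (\<open>Poly_iff\<close>); in other words \<open>Poly1\<close> and \<open>Poly2\<close> are the domain walls of \<open>X\<close>.

  Given \<open>X\<close>, the quadrangles are filled independently, so the sum of the weights is a product over
  the edges (\<open>sum_dimers_with_externals\<close>). With \<open>\<alpha>\<close> and \<open>\<beta>\<close> for the internal weights at an edge, parallel
  to it and to its dual, the factor is \<open>\<alpha>\<close> on \<open>P\<close>, \<open>\<beta>\<close> on \<open>Q\<close>, and on all other edges it is \<open>1\<close>: if all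
  sectors are present the quadrangle is empty, and if none is present there are two matchings, with
  total weight \<open>\<alpha>\<^sup>2 + \<beta>\<^sup>2 = 1\<close> (\<open>sum_completions\<close>). Hence the weight of
  \<open>Poly = (P, Q)\<close> is the product in the theorem times the number of sets \<open>X\<close> whose walls are
  \<open>(P, Q)\<close> (\<open>W_quadri_eq_card_patterns\<close>).

  That number is 2. A set of edges is null-homologous iff it is the set of edges at which some
  function on the faces jumps, and a set of dual edges is null-homologous iff it is the set of edges
  at which some function on the vertices jumps (\<open>boundaries_iff\<close>, \<open>dual_boundaries_iff\<close>). If \<open>f\<close>
  and \<open>g\<close> are such functions for \<open>P\<close> and \<open>Q\<close>, the corner of a face \<open>F\<close> at a vertex \<open>v\<close> can be
  labelled by \<open>f F + g v\<close> modulo 2: moving across an edge keeps \<open>v\<close>, and moving across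
  a dual edge keeps \<open>F\<close>. Two labellings with the same walls agree everywhere or
  nowhere because the graph is connected (\<open>card_patterns\<close>).

  The same correspondence read backwards closes the computation of the partition function: if \<open>Poly1\<close>
  of a dimer configuration is the jump set of \<open>f\<close>, then \<open>X + f\<close> is a function on the
  vertices, and its jump set is \<open>Poly2\<close>. So a null-homologous \<open>Poly1\<close> forces a null-homologous
  \<open>Poly2\<close> (\<open>Poly2_in_dual_polygon_configs0\<close>), and the sum over \<open>dimers0\<close> splits into the weights
  of the pairs.
\<close>

section \<open>Rotation systems and potentials\<close>

text \<open>
  These axioms are self-dual: they pass to the dual rotation because \<open>face_succ\<close> is again a
  permutation of the arcs. So what is proved from them about boundaries can be used both for a graph
  and for its dual.
\<close>

locale rotation_system =
  fixes G :: "('v, 'a) pre_digraph" and M :: "'a rotation"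
  assumes finite_arc_set: "finite (arcs G)"
    and rev_permutes: "edge_rev M permutes arcs G"
    and succ_perm: "edge_succ M permutes arcs G"
    and rev_rev: "edge_rev M (edge_rev M a) = a"
    and rev_neq: "a \<in> arcs G \<Longrightarrow> edge_rev M a \<noteq> a"
begin

abbreviation pred :: "'a \<Rightarrow> 'a" where
  "pred \<equiv> inv_into UNIV (edge_succ M)"

lemma succ_pred: "edge_succ M (pred a) = a" "pred (edge_succ M a) = a"
  using permutes_inverses[OF succ_perm] by auto

lemma face_succ_eq: "face_succ M a = pred (edge_rev M a)"
  by (simp add: face_succ_def)

lemma face_succ_permutes: "face_succ M permutes arcs G"
  unfolding face_succ_def
  by (intro permutes_compose rev_permutes permutes_inv succ_perm)

lemma inv_face_succ: "inv_into UNIV (face_succ M) a = edge_rev M (edge_succ M a)"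
  by (rule permutes_inv_eq[OF face_succ_permutes, THEN iffD2])
     (simp add: face_succ_eq rev_rev succ_pred)

lemma in_arcs [simp]:
  "edge_rev M a \<in> arcs G \<longleftrightarrow> a \<in> arcs G"
  "edge_succ M a \<in> arcs G \<longleftrightarrow> a \<in> arcs G"
  "pred a \<in> arcs G \<longleftrightarrow> a \<in> arcs G"
  "face_succ M a \<in> arcs G \<longleftrightarrow> a \<in> arcs G"
  using permutes_in_image[OF rev_permutes] permutes_in_image[OF succ_perm]
    permutes_in_image[OF permutes_inv[OF succ_perm]]
    permutes_in_image[OF face_succ_permutes] by auto

lemma face_succ_permutation: "permutation (face_succ M)"
  using face_succ_permutes finite_arc_set by (auto simp: permutation_permutes)

lemma left_face_face_succ [simp]: "left_face M (face_succ M a) = left_face M a"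
  unfolding left_face_def by (rule permutation_orbit_step[OF face_succ_permutation])

lemma self_in_left_face: "a \<in> left_face M a"
  unfolding left_face_def by (rule permutation_self_in_orbit[OF face_succ_permutation])

lemma left_face_subset: "a \<in> arcs G \<Longrightarrow> left_face M a \<subseteq> arcs G"
  unfolding left_face_def by (rule permutes_orbit_subset[OF face_succ_permutes])

text \<open>
  Turns invariance under one step around a face into constancy on the face, so that functions on
  faces can be handled as invariant functions on arcs.
\<close>

lemma constant_on_left_face:
  assumes "a \<in> arcs G" "b \<in> left_face M a"
    and inv: "\<And>c. c \<in> arcs G \<Longrightarrow> f (face_succ M c) = f c"
  shows "f b = f a"
  using assms(2) unfolding left_face_def
proof induction
  case base
  show ?case using assms(1) by (rule inv)
next
  case (step b)
  have "b \<in> arcs G"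
    using step.hyps left_face_subset[OF assms(1)] by (auto simp: left_face_def)
  then show ?case using step.IH inv by simp
qed

lemma arc_edge_rev [simp]: "arc_edge M (edge_rev M a) = arc_edge M a"
  by (auto simp: arc_edge_def rev_rev)

lemma arc_edge_in_edges [simp]: "a \<in> arcs G \<Longrightarrow> arc_edge M a \<in> edges G M"
  by (simp add: edges_def)

lemma edgesE:
  assumes "e \<in> edges G M"
  obtains a where "a \<in> arcs G" "e = arc_edge M a"
  using assms by (auto simp: edges_def)

lemma edge_of_arc: "e \<in> edges G M \<Longrightarrow> a \<in> e \<Longrightarrow> a \<in> arcs G \<and> e = arc_edge M a"
  by (auto simp: edges_def arc_edge_def rev_rev)

lemma edge_set_eqI:
  assumes "P \<subseteq> edges G M" "Q \<subseteq> edges G M"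
    and "\<And>a. a \<in> arcs G \<Longrightarrow> arc_edge M a \<in> P \<longleftrightarrow> arc_edge M a \<in> Q"
  shows "P = Q"
  using assms by (auto simp: edges_def)

lemma finite_edges: "finite (edges G M)"
  by (simp add: edges_def finite_arc_set)

lemma face_boundary_subset: "face_boundary G M F \<subseteq> edges G M"
  by (auto simp: face_boundary_def)

lemma arc_edge_in_face_boundary:
  assumes "a \<in> arcs G"
  shows "arc_edge M a \<in> face_boundary G M F \<longleftrightarrow>
    (left_face M a \<in> F) \<noteq> (left_face M (edge_rev M a) \<in> F)"
proof -
  have "{c \<in> arc_edge M a. left_face M c \<in> F} =
      (if left_face M a \<in> F then {a} else {}) \<union>
      (if left_face M (edge_rev M a) \<in> F then {edge_rev M a} else {})"
    by (auto simp: arc_edge_def)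
  moreover have "edge_rev M a \<noteq> a" using rev_neq[OF assms] .
  ultimately show ?thesis using assms by (auto simp: face_boundary_def)
qed

text \<open>
  A function modulo 2 on the orbits of \<open>\<sigma>\<close> whose coboundary is \<open>P\<close>. With \<open>face_succ\<close> for
  \<open>\<sigma>\<close> it is a function on faces, with \<open>edge_succ\<close> a function on vertices.
\<close>

definition potential :: "('a \<Rightarrow> 'a) \<Rightarrow> ('a \<Rightarrow> bool) \<Rightarrow> 'a set set \<Rightarrow> bool" where
  "potential \<sigma> f P \<longleftrightarrow>
     (\<forall>a\<in>arcs G. f (\<sigma> a) = f a \<and> (arc_edge M a \<in> P \<longleftrightarrow> f a \<noteq> f (edge_rev M a)))"

lemma potential_step: "potential \<sigma> f P \<Longrightarrow> a \<in> arcs G \<Longrightarrow> f (\<sigma> a) = f a"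
  by (simp add: potential_def)

lemma potential_edge:
  "potential \<sigma> f P \<Longrightarrow> a \<in> arcs G \<Longrightarrow> arc_edge M a \<in> P \<longleftrightarrow> f a \<noteq> f (edge_rev M a)"
  by (simp add: potential_def)

text \<open>
  The potential of a boundary is the indicator of the set of faces that it bounds, and conversely a
  face belongs to that set iff the potential holds on its arcs.
\<close>

lemma boundaries_iff:
  "P \<in> boundaries G M \<longleftrightarrow> P \<subseteq> edges G M \<and> (\<exists>f. potential (face_succ M) f P)"
  (is "_ \<longleftrightarrow> ?R")
proof
  assume "P \<in> boundaries G M"
  then obtain F where F: "P = face_boundary G M F"
    by (auto simp: boundaries_def)
  have "potential (face_succ M) (\<lambda>a. left_face M a \<in> F) P"
    by (simp add: potential_def F arc_edge_in_face_boundary)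
  then show ?R using F face_boundary_subset by blast
next
  assume ?R
  then obtain f where P: "P \<subseteq> edges G M" and f: "potential (face_succ M) f P"
    by blast
  define F where "F = left_face M ` {a \<in> arcs G. f a}"
  have *: "left_face M a \<in> F \<longleftrightarrow> f a" if a: "a \<in> arcs G" for a
  proof
    assume "left_face M a \<in> F"
    then obtain b where b: "b \<in> arcs G" "f b" "left_face M a = left_face M b"
      by (auto simp: F_def)
    with self_in_left_face[of a] have "a \<in> left_face M b" by simp
    from constant_on_left_face[where f = f, OF b(1) this potential_step[OF f]] b(2)
    show "f a" by simp
  qed (use a in \<open>auto simp: F_def\<close>)
  have "P = face_boundary G M F"
    by (rule edge_set_eqI[OF P face_boundary_subset])
       (simp add: arc_edge_in_face_boundary potential_edge[OF f] *)
  moreover have "F \<subseteq> faces G M" by (auto simp: F_def faces_def)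
  ultimately show "P \<in> boundaries G M" by (auto simp: boundaries_def)
qed

lemma empty_in_boundaries: "{} \<in> boundaries G M"
  unfolding boundaries_iff by (auto simp: potential_def intro!: exI[of _ "\<lambda>_. False"])

lemma sym_diff_in_boundaries:
  assumes "P \<in> boundaries G M" "Q \<in> boundaries G M"
  shows "sym_diff P Q \<in> boundaries G M"
proof -
  obtain f g where f: "P \<subseteq> edges G M" "potential (face_succ M) f P"
    and g: "Q \<subseteq> edges G M" "potential (face_succ M) g Q"
    using assms unfolding boundaries_iff by blast
  have "potential (face_succ M) (\<lambda>a. f a \<noteq> g a) (sym_diff P Q)"
    unfolding potential_def
  proof (intro ballI conjI)
    fix a assume a: "a \<in> arcs G"
    show "(f (face_succ M a) \<noteq> g (face_succ M a)) = (f a \<noteq> g a)"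
      using potential_step[OF f(2) a] potential_step[OF g(2) a] by simp
    show "(arc_edge M a \<in> sym_diff P Q) =
        ((f a \<noteq> g a) \<noteq> (f (edge_rev M a) \<noteq> g (edge_rev M a)))"
      using potential_edge[OF f(2) a] potential_edge[OF g(2) a] by blast
  qed
  then show ?thesis using f(1) g(1) unfolding boundaries_iff by blast
qed

text \<open>
  The class of \<open>P\<close> is the coset through \<open>P\<close> of the group of boundaries. Since boundaries are closed
  under addition, this is the trivial coset, the set of all boundaries, iff \<open>P\<close> is a boundary.
\<close>

lemma polygon_configs0_iff:
  "P \<in> polygon_configs0 G M \<longleftrightarrow> P \<in> polygon_configs G M \<and> P \<in> boundaries G M"
proof -
  have hc: "homology_class G M P = (\<lambda>B. sym_diff B P) ` boundaries G M"
    by (auto simp: homology_class_def r_coset_def cycle_group_def)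
  have one: "\<one>\<^bsub>H1 G M\<^esub> = boundaries G M"
    by (simp add: H1_def FactGroup_def)
  have "(\<lambda>B. sym_diff B P) ` boundaries G M = boundaries G M \<longleftrightarrow> P \<in> boundaries G M"
  proof
    assume "(\<lambda>B. sym_diff B P) ` boundaries G M = boundaries G M"
    moreover have "P \<in> (\<lambda>B. sym_diff B P) ` boundaries G M"
      using empty_in_boundaries by (intro image_eqI[of _ _ "{}"]) auto
    ultimately show "P \<in> boundaries G M" by simp
  next
    assume P: "P \<in> boundaries G M"
    have "B \<in> (\<lambda>B. sym_diff B P) ` boundaries G M" if "B \<in> boundaries G M" for B
      using sym_diff_in_boundaries[OF that P] by (intro image_eqI[of _ _ "sym_diff B P"]) auto
    then show "(\<lambda>B. sym_diff B P) ` boundaries G M = boundaries G M"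
      using sym_diff_in_boundaries[OF _ P] by auto
  qed
  then show ?thesis by (auto simp: polygon_configs0_def hc one)
qed

end

text \<open>
  A labelling changes an even number of times along closed walks. Counting gives it without looking
  at the walks: as many points are labelled true as have a successor labelled true.
\<close>

lemma even_card_changes:
  assumes "finite S" "bij_betw \<sigma> S S"
  shows "even (card {a \<in> S. (a \<in> X) \<noteq> (\<sigma> a \<in> X)})"
proof -
  define A where "A = {a \<in> S. a \<in> X}"
  define B where "B = {a \<in> S. \<sigma> a \<in> X}"
  have fin: "finite A" "finite B" using assms(1) by (auto simp: A_def B_def)
  have "bij_betw \<sigma> B A"
    using assms(2) by (auto simp: bij_betw_def A_def B_def intro: inj_on_subset)
  then have eq: "card B = card A" by (rule bij_betw_same_card)
  have "{a \<in> S. (a \<in> X) \<noteq> (\<sigma> a \<in> X)} = (A - B) \<union> (B - A)"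
    by (auto simp: A_def B_def)
  moreover have "card ((A - B) \<union> (B - A)) = card (A - B) + card (B - A)"
    using fin by (intro card_Un_disjoint) auto
  moreover have "card (A - B) = card (B - A)"
    using card_Int_Diff[OF fin(1), of B] card_Int_Diff[OF fin(2), of A] eq
    by (simp add: Int_commute)
  ultimately have "card {a \<in> S. (a \<in> X) \<noteq> (\<sigma> a \<in> X)} = 2 * card (A - B)"
    by (simp only: mult_2)
  then show ?thesis by simp
qed

sublocale cellular_embedding \<subseteq> rotation_system G M
  by unfold_locales (use arev_permutes_arcs succ_permutes arev_neq in auto)

context cellular_embedding
begin

lemma dual_edges [simp]: "edges (dual_graph G M) (dual_rotation M) = edges G M"
  by (simp add: edges_def dual_graph_def dual_rotation_def arc_edge_def)

lemma dual_rotation_system: "rotation_system (dual_graph G M) (dual_rotation M)"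
  by unfold_locales
     (simp_all add: dual_graph_def dual_rotation_def finite_arc_set rev_permutes
        face_succ_permutes rev_rev rev_neq)

lemma dual_face_succ:
  "face_succ (dual_rotation M) a = edge_rev M (edge_succ M (edge_rev M a))"
proof -
  have "face_succ (dual_rotation M) a = inv_into UNIV (face_succ M) (edge_rev M a)"
    unfolding face_succ_def[of "dual_rotation M"] by (simp add: dual_rotation_def)
  then show ?thesis by (simp add: inv_face_succ)
qed

text \<open>
  The faces of the dual are the vertices. An arc of the dual has the head of the
  original arc on its left, so a potential on dual faces becomes a potential on vertices after composition
  with the reversal of arcs.
\<close>

lemma dual_boundaries_iff:
  "Q \<in> boundaries (dual_graph G M) (dual_rotation M) \<longleftrightarrow>
     Q \<subseteq> edges G M \<and> (\<exists>g. potential (edge_succ M) g Q)"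
proof -
  interpret dual: rotation_system "dual_graph G M" "dual_rotation M"
    by (rule dual_rotation_system)
  let ?\<sigma> = "face_succ (dual_rotation M)"
  have dual_potential: "dual.potential ?\<sigma> f Q \<longleftrightarrow> potential ?\<sigma> f Q" for f
    unfolding dual.potential_def potential_def
    by (simp add: arc_edge_def[abs_def]) (simp add: dual_graph_def dual_rotation_def)
  have "potential (edge_succ M) (\<lambda>a. f (edge_rev M a)) Q" if f: "potential ?\<sigma> f Q" for f
    unfolding potential_def
  proof (intro ballI conjI)
    fix a assume a: "a \<in> arcs G"
    show "f (edge_rev M (edge_succ M a)) = f (edge_rev M a)"
      using potential_step[OF f, of "edge_rev M a"] a by (simp add: dual_face_succ rev_rev)
    show "(arc_edge M a \<in> Q) = (f (edge_rev M a) \<noteq> f (edge_rev M (edge_rev M a)))"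
      using potential_edge[OF f a] by (simp only: rev_rev) blast
  qed
  moreover have "potential ?\<sigma> (\<lambda>a. g (edge_rev M a)) Q"
    if g: "potential (edge_succ M) g Q" for g
    unfolding potential_def
  proof (intro ballI conjI)
    fix a assume a: "a \<in> arcs G"
    show "g (edge_rev M (?\<sigma> a)) = g (edge_rev M a)"
      using potential_step[OF g, of "edge_rev M a"] a by (simp add: dual_face_succ rev_rev)
    show "(arc_edge M a \<in> Q) = (g (edge_rev M a) \<noteq> g (edge_rev M (edge_rev M a)))"
      using potential_edge[OF g a] by (simp only: rev_rev) blast
  qed
  ultimately show ?thesis
    unfolding dual.boundaries_iff dual_edges dual_potential by blast
qed

text \<open>
  The form in which connectedness of the graph is used: rotation reaches all arcs at a vertex, and
  reversal moves along an edge.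
\<close>

lemma arcs_connected:
  assumes S: "S \<subseteq> arcs G" "S \<noteq> {}"
    and succ: "\<And>a. a \<in> S \<Longrightarrow> edge_succ M a \<in> S"
    and rev: "\<And>a. a \<in> S \<Longrightarrow> edge_rev M a \<in> S"
  shows "S = arcs G"
proof -
  have star: "out_arcs G (tail G a) \<subseteq> S" if a: "a \<in> S" for a
  proof -
    have "a \<in> out_arcs G (tail G a)" "tail G a \<in> verts G"
      using a S(1) by (auto simp: in_out_arcs_conv)
    moreover from this have "cyclic_on (edge_succ M) (out_arcs G (tail G a))"
      by (intro succ_cyclic) auto
    ultimately have "out_arcs G (tail G a) = orbit (edge_succ M) a"
      by (metis orbit_cyclic_eq3)
    moreover have "b \<in> S" if "b \<in> orbit (edge_succ M) a" for b
      using that by induction (use a succ in auto)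
    ultimately show ?thesis by auto
  qed
  interpret sym: pair_wf_digraph "mk_symmetric G" ..
  obtain s where s: "s \<in> S" using S(2) by auto
  have verts: "out_arcs G v \<subseteq> S" if "v \<in> verts G" for v
  proof -
    have "tail G s \<rightarrow>\<^sup>*\<^bsub>mk_symmetric G\<^esub> v"
      using connected_graph s S(1) that
      by (auto simp: Digraph_Component.connected_def strongly_connected_def)
    then show ?thesis
    proof (rule sym.reachable_induct[where P = "\<lambda>v. out_arcs G v \<subseteq> S"], goal_cases base step)
      case base
      show ?case using star[OF s] .
    next
      case (step u w)
      then have "\<exists>a\<in>arcs G. (tail G a = u \<and> head G a = w) \<or> (tail G a = w \<and> head G a = u)"
        by (auto simp: parcs_mk_symmetric)
      then obtain a where a: "a \<in> arcs G" "tail G a = u" "head G a = w"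
        by (metis arev_in_arcs head_arev tail_arev)
      with step(3) have "edge_rev M a \<in> S" by (auto simp: in_out_arcs_conv intro!: rev)
      from star[OF this] a show ?case by simp
    qed
  qed
  show ?thesis
  proof
    show "arcs G \<subseteq> S"
    proof
      fix a assume "a \<in> arcs G"
      then show "a \<in> S" using verts[of "tail G a"] by auto
    qed
  qed (rule S(1))
qed

end

section \<open>Matchings of a single quadrangle\<close>

text \<open>
  The arc whose external edge ends at a given corner of a quadrangle.
\<close>

fun corner_arc :: "'a rotation \<Rightarrow> 'a corner \<Rightarrow> 'a" where
  "corner_arc M (a, Lft) = a"
| "corner_arc M (a, Rgt) = inv_into UNIV (edge_succ M) a"

definition externals :: "'a qedge set \<Rightarrow> 'a set" where
  "externals D = {a. External a \<in> D}"

definition quadrangle :: "'a set \<Rightarrow> 'a qedge set" where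
  "quadrangle e = ParPrimal ` e \<union> ParDual ` e"

text \<open>
  The perfect matchings, by internal edges, of those corners of one quadrangle that the external
  edges in \<open>X\<close> leave free.
\<close>

definition completions :: "'a rotation \<Rightarrow> 'a set \<Rightarrow> 'a set \<Rightarrow> 'a qedge set set" where
  "completions M X e = {N. N \<subseteq> quadrangle e \<and> (\<forall>c\<in>e \<times> UNIV.
     if corner_arc M c \<in> X then \<forall>x\<in>N. c \<notin> qends M x else \<exists>!x. x \<in> N \<and> c \<in> qends M x)}"

lemma UNIV_side: "UNIV = {Lft, Rgt}"
  using side.exhaust by blast

lemma ex1_pair_iff: "(\<exists>!x. x \<in> N \<and> (x = u \<or> x = v)) \<longleftrightarrow> (u \<in> N \<and> v \<notin> N) \<or> (u \<notin> N \<and> v \<in> N)"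
  if "u \<noteq> v" using that by metis

context rotation_system
begin

lemma qends_External_iff: "c \<in> qends M (External a) \<longleftrightarrow> a = corner_arc M c"
  by (cases c; cases "snd c") (auto simp: succ_pred)

lemma qends_cases:
  assumes "c \<in> qends M x"
  shows "x = External (corner_arc M c) \<or> x \<in> quadrangle (arc_edge M (fst c))"
proof (cases x)
  case (External a)
  then show ?thesis using assms qends_External_iff[of c a] by simp
qed (use assms in \<open>auto simp: quadrangle_def arc_edge_def rev_rev\<close>)

text \<open>
  Being a dimer configuration is a local condition once the external edges are known, because every corner is
  an end of exactly one external edge, and all its other edges belong to its own quadrangle.
\<close>

lemma dimers_iff:
  "D \<in> dimers G M \<longleftrightarrow>
     D \<subseteq> qedges G \<and> (\<forall>e\<in>edges G M. D \<inter> quadrangle e \<in> completions M (externals D) e)"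
proof -
  have corner: "(\<exists>!x. x \<in> D \<and> c \<in> qends M x) \<longleftrightarrow>
      (if corner_arc M c \<in> externals D then \<forall>x\<in>D \<inter> quadrangle (arc_edge M (fst c)). c \<notin> qends M x
       else \<exists>!x. x \<in> D \<inter> quadrangle (arc_edge M (fst c)) \<and> c \<in> qends M x)" for c
  proof -
    let ?Q = "quadrangle (arc_edge M (fst c))"
    have q: "x = External (corner_arc M c) \<or> x \<in> ?Q" if "c \<in> qends M x" for x
      using that by (rule qends_cases)
    have covers: "c \<in> qends M (External (corner_arc M c))"
      by (simp only: qends_External_iff)
    have ext: "External (corner_arc M c) \<notin> ?Q" by (auto simp: quadrangle_def)
    show ?thesis
    proof (cases "External (corner_arc M c) \<in> D")
      case True
      then have "(\<exists>!x. x \<in> D \<and> c \<in> qends M x) \<longleftrightarrow> (\<forall>x\<in>D \<inter> ?Q. c \<notin> qends M x)"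
        using q ext covers by (metis IntD1 IntD2 IntI)
      then show ?thesis using True by (simp add: externals_def)
    next
      case False
      then have "x \<in> D \<and> c \<in> qends M x \<longleftrightarrow> x \<in> D \<inter> ?Q \<and> c \<in> qends M x" for x
        using q by blast
      note * = this
      show ?thesis
        by (simp only: externals_def mem_Collect_eq False if_False *)
    qed
  qed
  have "(\<forall>c\<in>qverts G. \<exists>!x. x \<in> D \<and> c \<in> qends M x) \<longleftrightarrow>
      (\<forall>e\<in>edges G M. \<forall>c\<in>e \<times> UNIV. \<exists>!x. x \<in> D \<and> c \<in> qends M x)"
  proof -
    have "qverts G = (\<Union>e\<in>edges G M. e \<times> UNIV)"
      by (auto simp: qverts_def edges_def arc_edge_def)
    then show ?thesis by (simp only: ball_UN)
  qed
  also have "\<dots> \<longleftrightarrow> (\<forall>e\<in>edges G M. D \<inter> quadrangle e \<in> completions M (externals D) e)"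
  proof (rule ball_cong[OF refl])
    fix e assume e: "e \<in> edges G M"
    have "arc_edge M (fst c) = e" if "c \<in> e \<times> UNIV" for c :: "'a corner"
      using edge_of_arc[OF e, of "fst c"] that by auto
    then have "(\<forall>c\<in>e \<times> UNIV. \<exists>!x. x \<in> D \<and> c \<in> qends M x) \<longleftrightarrow>
        (\<forall>c\<in>e \<times> UNIV. if corner_arc M c \<in> externals D then \<forall>x\<in>D \<inter> quadrangle e. c \<notin> qends M x
           else \<exists>!x. x \<in> D \<inter> quadrangle e \<and> c \<in> qends M x)"
      by (intro ball_cong refl) (simp only: corner)
    then show "(\<forall>c\<in>e \<times> UNIV. \<exists>!x. x \<in> D \<and> c \<in> qends M x) \<longleftrightarrow>
        D \<inter> quadrangle e \<in> completions M (externals D) e"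
      by (simp only: completions_def mem_Collect_eq Int_lower2 simp_thms)
  qed
  finally show ?thesis by (simp add: dimers_def)
qed

lemma externals_subset: "D \<in> dimers G M \<Longrightarrow> externals D \<subseteq> arcs G"
  by (auto simp: dimers_def externals_def qedges_def)

lemma finite_dimers: "finite (dimers G M)"
proof (rule finite_subset)
  show "dimers G M \<subseteq> Pow (qedges G)" by (auto simp: dimers_def)
qed (simp add: qedges_def finite_arc_set)

text \<open>
  The quadrangle is a 4-cycle, so each of its corners gives a condition on the two internal edges that meet
  there. In this propositional form the matchings can be found by case analysis.
\<close>

lemma completions_iff:
  assumes a: "a \<in> arcs G" and b: "b = edge_rev M a"
  shows "N \<in> completions M X (arc_edge M a) \<longleftrightarrow>
    N \<subseteq> {ParPrimal a, ParPrimal b, ParDual a, ParDual b} \<and>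
    (if a \<in> X then ParPrimal a \<notin> N \<and> ParDual a \<notin> N
     else (ParPrimal a \<in> N) \<noteq> (ParDual a \<in> N)) \<and>
    (if pred a \<in> X then ParPrimal b \<notin> N \<and> ParDual a \<notin> N
     else (ParPrimal b \<in> N) \<noteq> (ParDual a \<in> N)) \<and>
    (if b \<in> X then ParPrimal b \<notin> N \<and> ParDual b \<notin> N
     else (ParPrimal b \<in> N) \<noteq> (ParDual b \<in> N)) \<and>
    (if pred b \<in> X then ParPrimal a \<notin> N \<and> ParDual b \<notin> N
     else (ParPrimal a \<in> N) \<noteq> (ParDual b \<in> N))"
proof -
  have ab: "a \<noteq> b" "edge_rev M a = b" "edge_rev M b = a"
    using rev_neq[OF a] by (simp_all add: b rev_rev eq_commute)
  have quad: "quadrangle (arc_edge M a) = {ParPrimal a, ParPrimal b, ParDual a, ParDual b}"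
    by (auto simp: quadrangle_def arc_edge_def ab)
  have corners: "arc_edge M a \<times> UNIV = {(a, Lft), (a, Rgt), (b, Lft), (b, Rgt)}"
    by (auto simp: arc_edge_def UNIV_side ab)
  have local_cond: "(if p then \<forall>x\<in>N. c \<notin> qends M x else \<exists>!x. x \<in> N \<and> c \<in> qends M x) \<longleftrightarrow>
      (if p then u \<notin> N \<and> v \<notin> N else (u \<in> N) \<noteq> (v \<in> N))"
    if "N \<subseteq> quadrangle (arc_edge M a)" "u \<noteq> v"
      "\<And>x. x \<in> quadrangle (arc_edge M a) \<Longrightarrow> c \<in> qends M x \<longleftrightarrow> x = u \<or> x = v" for p c u v
  proof -
    have "x \<in> N \<and> c \<in> qends M x \<longleftrightarrow> x \<in> N \<and> (x = u \<or> x = v)" for x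
      using that by blast
    note * = this
    have "(\<forall>x\<in>N. c \<notin> qends M x) \<longleftrightarrow> u \<notin> N \<and> v \<notin> N" using * by metis
    moreover have "(\<exists>!x. x \<in> N \<and> c \<in> qends M x) \<longleftrightarrow> (u \<in> N) \<noteq> (v \<in> N)"
      unfolding * ex1_pair_iff[OF that(2), of N] by blast
    ultimately show ?thesis by simp
  qed
  show ?thesis
  proof (cases "N \<subseteq> quadrangle (arc_edge M a)")
    case True
    have 1: "(if a \<in> X then \<forall>x\<in>N. (a, Lft) \<notin> qends M x else \<exists>!x. x \<in> N \<and> (a, Lft) \<in> qends M x) \<longleftrightarrow>
      (if a \<in> X then ParPrimal a \<notin> N \<and> ParDual a \<notin> N
       else (ParPrimal a \<in> N) \<noteq> (ParDual a \<in> N))"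
      by (rule local_cond[OF True]) (auto simp: ab quad)
    have 2: "(if pred a \<in> X then \<forall>x\<in>N. (a, Rgt) \<notin> qends M x else \<exists>!x. x \<in> N \<and> (a, Rgt) \<in> qends M x) \<longleftrightarrow>
      (if pred a \<in> X then ParPrimal b \<notin> N \<and> ParDual a \<notin> N
       else (ParPrimal b \<in> N) \<noteq> (ParDual a \<in> N))"
      by (rule local_cond[OF True]) (auto simp: ab quad)
    have 3: "(if b \<in> X then \<forall>x\<in>N. (b, Lft) \<notin> qends M x else \<exists>!x. x \<in> N \<and> (b, Lft) \<in> qends M x) \<longleftrightarrow>
      (if b \<in> X then ParPrimal b \<notin> N \<and> ParDual b \<notin> N
       else (ParPrimal b \<in> N) \<noteq> (ParDual b \<in> N))"
      by (rule local_cond[OF True]) (auto simp: ab quad)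
    have 4: "(if pred b \<in> X then \<forall>x\<in>N. (b, Rgt) \<notin> qends M x else \<exists>!x. x \<in> N \<and> (b, Rgt) \<in> qends M x) \<longleftrightarrow>
      (if pred b \<in> X then ParPrimal a \<notin> N \<and> ParDual b \<notin> N
       else (ParPrimal a \<in> N) \<noteq> (ParDual b \<in> N))"
      by (rule local_cond[OF True]) (auto simp: ab quad)
    show ?thesis
      unfolding completions_def mem_Collect_eq quad corners using True[unfolded quad]
      by (simp only: Set.ball_simps corner_arc.simps 1 2 3 4 simp_thms)
  next
    case False
    then show ?thesis unfolding completions_def quad by simp
  qed
qed

lemma completions_cases:
  assumes a: "a \<in> arcs G" and b: "b = edge_rev M a"
    and C_def: "C = completions M X (arc_edge M a)"
  shows "a \<in> X \<Longrightarrow> pred a \<in> X \<Longrightarrow> b \<in> X \<Longrightarrow> pred b \<in> X \<Longrightarrow> C = {{}}"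
    and "a \<notin> X \<Longrightarrow> pred a \<notin> X \<Longrightarrow> b \<notin> X \<Longrightarrow> pred b \<notin> X \<Longrightarrow>
      C = {{ParPrimal a, ParPrimal b}, {ParDual a, ParDual b}}"
    and "a \<in> X \<Longrightarrow> pred a \<notin> X \<Longrightarrow> b \<notin> X \<Longrightarrow> pred b \<in> X \<Longrightarrow> C = {{ParPrimal b}}"
    and "a \<notin> X \<Longrightarrow> pred a \<in> X \<Longrightarrow> b \<in> X \<Longrightarrow> pred b \<notin> X \<Longrightarrow> C = {{ParPrimal a}}"
    and "a \<in> X \<Longrightarrow> pred a \<in> X \<Longrightarrow> b \<notin> X \<Longrightarrow> pred b \<notin> X \<Longrightarrow> C = {{ParDual b}}"
    and "a \<notin> X \<Longrightarrow> pred a \<notin> X \<Longrightarrow> b \<in> X \<Longrightarrow> pred b \<in> X \<Longrightarrow> C = {{ParDual a}}"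
proof -
  have ab: "a \<noteq> b" using rev_neq[OF a] by (auto simp: b)
  note iff = completions_iff[OF a b]
  show "a \<in> X \<Longrightarrow> pred a \<in> X \<Longrightarrow> b \<in> X \<Longrightarrow> pred b \<in> X \<Longrightarrow> C = {{}}"
    "a \<notin> X \<Longrightarrow> pred a \<notin> X \<Longrightarrow> b \<notin> X \<Longrightarrow> pred b \<notin> X \<Longrightarrow>
      C = {{ParPrimal a, ParPrimal b}, {ParDual a, ParDual b}}"
    "a \<in> X \<Longrightarrow> pred a \<notin> X \<Longrightarrow> b \<notin> X \<Longrightarrow> pred b \<in> X \<Longrightarrow> C = {{ParPrimal b}}"
    "a \<notin> X \<Longrightarrow> pred a \<in> X \<Longrightarrow> b \<in> X \<Longrightarrow> pred b \<notin> X \<Longrightarrow> C = {{ParPrimal a}}"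
    "a \<in> X \<Longrightarrow> pred a \<in> X \<Longrightarrow> b \<notin> X \<Longrightarrow> pred b \<notin> X \<Longrightarrow> C = {{ParDual b}}"
    "a \<notin> X \<Longrightarrow> pred a \<notin> X \<Longrightarrow> b \<in> X \<Longrightarrow> pred b \<in> X \<Longrightarrow> C = {{ParDual a}}"
    using ab unfolding C_def set_eq_iff iff by (auto simp: subset_iff)
qed

end

section \<open>Dimer configurations with prescribed domain walls\<close>

definition primal_weight :: "('a set \<Rightarrow> real) \<Rightarrow> 'a set \<Rightarrow> real" where
  "primal_weight J e = 2 * exp (- 2 * J e) / (1 + exp (- 4 * J e))"

definition dual_weight :: "('a set \<Rightarrow> real) \<Rightarrow> 'a set \<Rightarrow> real" where
  "dual_weight J e = (1 - exp (- 4 * J e)) / (1 + exp (- 4 * J e))"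

text \<open>
  With \<open>t = exp (- 2 J)\<close> this is the Pythagorean identity
  \<open>(2 t)\<^sup>2 + (1 - t\<^sup>2)\<^sup>2 = (1 + t\<^sup>2)\<^sup>2\<close>.
\<close>

lemma weight_squares: "(primal_weight J e)\<^sup>2 + (dual_weight J e)\<^sup>2 = 1"
proof -
  define t where "t = exp (- 2 * J e)"
  have t4: "exp (- 4 * J e) = t\<^sup>2"
    unfolding t_def by (simp add: power2_eq_square flip: exp_add)
  have pos: "1 + t\<^sup>2 \<noteq> 0" by (smt (verit) zero_le_power2)
  have "(2 * t)\<^sup>2 + (1 - t\<^sup>2)\<^sup>2 = (1 + t\<^sup>2)\<^sup>2" by algebra
  then show ?thesis
    unfolding primal_weight_def dual_weight_def t4 t_def[symmetric] power_divide
    using pos by (simp flip: add_divide_distrib)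
qed

context rotation_system
begin

text \<open>
  The labellings of the corners of faces with domain walls \<open>P\<close> and \<open>Q\<close>. An arc \<open>a\<close> names the
  corner to its left at its tail. The corner to its right at its tail is \<open>pred a\<close>, across the
  edge; the corner to its left at its head is \<open>face_succ M a\<close>, across the dual edge.
\<close>

definition patterns :: "'a set set \<Rightarrow> 'a set set \<Rightarrow> 'a set set" where
  "patterns P Q = {X. X \<subseteq> arcs G \<and> (\<forall>a\<in>arcs G.
     (arc_edge M a \<in> P \<longleftrightarrow> (a \<in> X) \<noteq> (pred a \<in> X)) \<and>
     (arc_edge M a \<in> Q \<longleftrightarrow> (a \<in> X) \<noteq> (face_succ M a \<in> X)))}"

lemma patterns_primal:
  "X \<in> patterns P Q \<Longrightarrow> a \<in> arcs G \<Longrightarrow> arc_edge M a \<in> P \<longleftrightarrow> (a \<in> X) \<noteq> (pred a \<in> X)"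
  by (simp add: patterns_def)

lemma patterns_dual:
  "X \<in> patterns P Q \<Longrightarrow> a \<in> arcs G \<Longrightarrow>
     arc_edge M a \<in> Q \<longleftrightarrow> (a \<in> X) \<noteq> (pred (edge_rev M a) \<in> X)"
  by (simp add: patterns_def face_succ_eq)

text \<open>
  At each edge only an even number of sectors can be present, since the internal edges cover corners in pairs,
  and two opposite sectors cannot be the only ones, since opposite corners are not joined.
\<close>

lemma dimer_sectors:
  assumes D: "D \<in> dimers G M" and a: "a \<in> arcs G" and b: "b = edge_rev M a"
    and X: "X = externals D"
  shows "(a \<in> X) = (pred a \<in> X) \<or> (a \<in> X) = (pred b \<in> X)"
    and "(b \<in> X) = (((a \<in> X) = (pred a \<in> X)) = (pred b \<in> X))"
proof -
  have "D \<inter> quadrangle (arc_edge M a) \<in> completions M X (arc_edge M a)"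
    using D a unfolding dimers_iff X by simp
  note c = conjunct2[OF this[unfolded completions_iff[OF a b]]]
  show "(a \<in> X) = (pred a \<in> X) \<or> (a \<in> X) = (pred b \<in> X)"
    using c by argo
  show "(b \<in> X) = (((a \<in> X) = (pred a \<in> X)) = (pred b \<in> X))"
    using c by argo
qed

lemma present_sectors_eq:
  "present_sectors M D e = {c \<in> e \<times> UNIV. corner_arc M c \<in> externals D}"
  unfolding present_sectors_def qends_External_iff externals_def by blast

lemma Poly_iff:
  assumes D: "D \<in> dimers G M" and a: "a \<in> arcs G" and X: "X = externals D"
  shows "arc_edge M a \<in> Poly1 G M D \<longleftrightarrow> (a \<in> X) \<noteq> (pred a \<in> X)"
    and "arc_edge M a \<in> Poly2 G M D \<longleftrightarrow> (a \<in> X) \<noteq> (pred (edge_rev M a) \<in> X)"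
proof -
  define b where "b = edge_rev M a"
  have ab: "a \<noteq> b" "edge_rev M b = a" "edge_rev M a = b"
    using rev_neq[OF a] by (simp_all add: b_def rev_rev eq_commute)
  note sec = dimer_sectors[OF D a b_def X]
  define S where "S = present_sectors M D (arc_edge M a)"
  have sub: "S \<subseteq> {(a, Lft), (a, Rgt), (b, Lft), (b, Rgt)}"
    by (auto simp: S_def present_sectors_eq arc_edge_def ab UNIV_side)
  have mem: "(a, Lft) \<in> S \<longleftrightarrow> a \<in> X" "(a, Rgt) \<in> S \<longleftrightarrow> pred a \<in> X"
    "(b, Lft) \<in> S \<longleftrightarrow> b \<in> X" "(b, Rgt) \<in> S \<longleftrightarrow> pred b \<in> X"
    by (auto simp: S_def present_sectors_eq arc_edge_def ab X)
  have eqs: "S = {(a, Lft), (b, Rgt)} \<longleftrightarrow> a \<in> X \<and> pred a \<notin> X \<and> b \<notin> X \<and> pred b \<in> X"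
    "S = {(b, Lft), (a, Rgt)} \<longleftrightarrow> a \<notin> X \<and> pred a \<in> X \<and> b \<in> X \<and> pred b \<notin> X"
    "S = {(a, Lft), (a, Rgt)} \<longleftrightarrow> a \<in> X \<and> pred a \<in> X \<and> b \<notin> X \<and> pred b \<notin> X"
    "S = {(b, Lft), (b, Rgt)} \<longleftrightarrow> a \<notin> X \<and> pred a \<notin> X \<and> b \<in> X \<and> pred b \<in> X"
    unfolding mem[symmetric] using sub ab(1) by blast+
  have arc_edge: "arc_edge M a = {a, b}" by (simp add: arc_edge_def b_def)
  have "arc_edge M a \<in> Poly1 G M D \<longleftrightarrow> S = {(a, Lft), (b, Rgt)} \<or> S = {(b, Lft), (a, Rgt)}"
    using arc_edge_in_edges[OF a] by (simp add: Poly1_def flip: S_def) (simp add: arc_edge ab)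
  then show "arc_edge M a \<in> Poly1 G M D \<longleftrightarrow> (a \<in> X) \<noteq> (pred a \<in> X)"
    unfolding eqs using sec by argo
  have "edges (dual_graph G M) (dual_rotation M) = edges G M"
    by (simp add: edges_def dual_graph_def dual_rotation_def arc_edge_def)
  then have "arc_edge M a \<in> Poly2 G M D \<longleftrightarrow> S = {(a, Lft), (a, Rgt)} \<or> S = {(b, Lft), (b, Rgt)}"
    using arc_edge_in_edges[OF a] by (simp add: Poly2_def flip: S_def) (simp add: arc_edge ab)
  then show "arc_edge M a \<in> Poly2 G M D \<longleftrightarrow> (a \<in> X) \<noteq> (pred (edge_rev M a) \<in> X)"
    unfolding eqs ab(3) using sec by argo
qed

lemma Poly_subset: "Poly1 G M D \<subseteq> edges G M" "Poly2 G M D \<subseteq> edges G M"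
  by (auto simp: Poly1_def Poly2_def edges_def dual_graph_def dual_rotation_def arc_edge_def)

lemma Poly_disjoint:
  assumes D: "D \<in> dimers G M"
  shows "Poly1 G M D \<inter> Poly2 G M D = {}"
proof -
  have "arc_edge M a \<notin> Poly1 G M D \<inter> Poly2 G M D" if a: "a \<in> arcs G" for a
    using dimer_sectors(1)[OF D a refl refl] Poly_iff[OF D a refl] by blast
  moreover have "e \<in> edges G M" if "e \<in> Poly1 G M D \<inter> Poly2 G M D" for e
    using that Poly_subset(1) by blast
  ultimately show ?thesis by (metis edgesE equals0I)
qed

text \<open>
  \<open>Poly\<close> depends on the external edges alone, so fixing its value only restricts \<open>X\<close>.
\<close>

lemma Poly_eq_iff:
  assumes D: "D \<in> dimers G M" and PQ: "P \<subseteq> edges G M" "Q \<subseteq> edges G M"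
  shows "Poly G M D = (P, Q) \<longleftrightarrow> externals D \<in> patterns P Q"
proof
  assume "Poly G M D = (P, Q)"
  then show "externals D \<in> patterns P Q"
    using Poly_iff[OF D _ refl] externals_subset[OF D]
    unfolding patterns_def face_succ_eq Poly_def by blast
next
  assume X: "externals D \<in> patterns P Q"
  have "Poly1 G M D = P" "Poly2 G M D = Q"
    by (rule edge_set_eqI[OF Poly_subset(1) PQ(1)] edge_set_eqI[OF Poly_subset(2) PQ(2)],
        simp only: patterns_primal[OF X] patterns_dual[OF X] Poly_iff[OF D _ refl])+
  then show "Poly G M D = (P, Q)" by (simp add: Poly_def)
qed

text \<open>
  On a wall exactly one internal edge is needed. Away from the walls the four sectors agree: the quadrangle is
  empty or is matched in one of two ways, and in both cases the total weight is \<open>1\<close>.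
\<close>

lemma sum_completions:
  assumes X: "X \<in> patterns P Q" and disj: "P \<inter> Q = {}" and e: "e \<in> edges G M"
  shows "(\<Sum>N\<in>completions M X e. \<Prod>x\<in>N. qweight M J x) =
    (if e \<in> P then primal_weight J e else if e \<in> Q then dual_weight J e else 1)"
proof -
  obtain a where a: "a \<in> arcs G" and ea: "e = arc_edge M a" using e by (rule edgesE)
  define b where "b = edge_rev M a"
  have b: "b \<in> arcs G" "edge_rev M b = a" "arc_edge M b = e" "a \<noteq> b"
    using a ea rev_neq[OF a] by (simp_all add: b_def rev_rev eq_commute)
  have P: "e \<in> P \<longleftrightarrow> (a \<in> X) \<noteq> (pred a \<in> X)" "e \<in> P \<longleftrightarrow> (b \<in> X) \<noteq> (pred b \<in> X)"
    using patterns_primal[OF X a] patterns_primal[OF X b(1)] b(3) ea by auto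
  have Q: "e \<in> Q \<longleftrightarrow> (a \<in> X) \<noteq> (pred b \<in> X)" "e \<in> Q \<longleftrightarrow> (b \<in> X) \<noteq> (pred a \<in> X)"
    using patterns_dual[OF X a] patterns_dual[OF X b(1)] b(3)
    by (simp_all only: b(2) ea flip: b_def)
  have w: "qweight M J (ParPrimal a) = primal_weight J e" "qweight M J (ParPrimal b) = primal_weight J e"
    "qweight M J (ParDual a) = dual_weight J e" "qweight M J (ParDual b) = dual_weight J e"
    using b(3) by (simp_all add: ea primal_weight_def dual_weight_def)
  note cs = completions_cases[OF a b_def, of _ X, folded ea, OF refl]
  consider "e \<in> P" "e \<notin> Q" | "e \<notin> P" "e \<in> Q" | "e \<notin> P" "e \<notin> Q" using disj by blast
  then show ?thesis
  proof cases
    case 1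
    then show ?thesis using P Q cs(3,4) w by (cases "a \<in> X") auto
  next
    case 2
    then show ?thesis using P Q cs(5,6) w by (cases "a \<in> X") auto
  next
    case 3
    show ?thesis
    proof (cases "a \<in> X")
      case True
      then show ?thesis using P Q cs(1) w 3 by auto
    next
      case False
      then have "completions M X e = {{ParPrimal a, ParPrimal b}, {ParDual a, ParDual b}}"
        using P Q cs(2) 3 by blast
      moreover have "{ParPrimal a, ParPrimal b} \<noteq> {ParDual a, ParDual b}" by auto
      ultimately have "(\<Sum>N\<in>completions M X e. \<Prod>x\<in>N. qweight M J x) =
          (primal_weight J e)\<^sup>2 + (dual_weight J e)\<^sup>2"
        using b(4) w by (simp add: power2_eq_square)
      then show ?thesis using weight_squares[of J e] 3 by simp
    qed
  qed
qed

lemma quadrangle_disjoint: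
  "e \<in> edges G M \<Longrightarrow> e' \<in> edges G M \<Longrightarrow> e \<noteq> e' \<Longrightarrow> quadrangle e \<inter> quadrangle e' = {}"
  by (auto simp: quadrangle_def dest: edge_of_arc)

lemma finite_quadrangle: "e \<in> edges G M \<Longrightarrow> finite (quadrangle e)"
  by (auto simp: quadrangle_def edges_def arc_edge_def)

lemma qedges_eq: "qedges G = External ` arcs G \<union> (\<Union>e\<in>edges G M. quadrangle e)"
  by (auto simp: qedges_def quadrangle_def edges_def arc_edge_def)

lemma completions_subset: "completions M X e \<subseteq> Pow (quadrangle e)"
  by (auto simp: completions_def)

lemma dimer_eq_externals_Un_quadrangles:
  "D \<subseteq> qedges G \<Longrightarrow> D = External ` externals D \<union> (\<Union>e\<in>edges G M. D \<inter> quadrangle e)"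
  unfolding qedges_eq by (auto simp: externals_def)

text \<open>
  Dimer configurations with external edges \<open>X\<close> are families of independent choices, one
  completion per quadrangle, so the sum of products is a product of sums.
\<close>

lemma sum_dimers_with_externals:
  assumes X: "X \<subseteq> arcs G"
  shows "(\<Sum>D\<in>{D \<in> dimers G M. externals D = X}. dimer_weight M J D) =
    (\<Prod>e\<in>edges G M. \<Sum>N\<in>completions M X e. \<Prod>x\<in>N. qweight M J x)"
proof -
  let ?E = "edges G M" and ?C = "completions M X"
  define glue where "glue g = External ` X \<union> (\<Union>e\<in>?E. g e)" for g
  have ext: "externals (glue g) = X" if "g \<in> Pi\<^sub>E ?E ?C" for g
    using that by (fastforce simp: glue_def externals_def quadrangle_def completions_def PiE_def Pi_def)
  have loc: "glue g \<inter> quadrangle e = g e" if g: "g \<in> Pi\<^sub>E ?E ?C" and e: "e \<in> ?E" for g e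
  proof -
    have sub: "g e' \<subseteq> quadrangle e'" if "e' \<in> ?E" for e'
      using PiE_mem[OF g that] completions_subset by blast
    have "g e' \<inter> quadrangle e = {}" if "e' \<in> ?E" "e' \<noteq> e" for e'
      using sub[OF that(1)] quadrangle_disjoint[OF that(1) e that(2)] by blast
    moreover have "External ` X \<inter> quadrangle e = {}" by (auto simp: quadrangle_def)
    ultimately show ?thesis using sub[OF e] e unfolding glue_def by blast
  qed
  have fin: "finite (?C e)" if "e \<in> ?E" for e
    using finite_subset[OF completions_subset] finite_quadrangle[OF that] by simp
  have "(\<Sum>D\<in>{D \<in> dimers G M. externals D = X}. dimer_weight M J D) =
      (\<Sum>g\<in>Pi\<^sub>E ?E ?C. \<Prod>e\<in>?E. \<Prod>x\<in>g e. qweight M J x)"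
  proof (rule sum.reindex_bij_witness[where i = glue and j = "\<lambda>D. \<lambda>e\<in>?E. D \<inter> quadrangle e"])
    fix D assume D: "D \<in> {D \<in> dimers G M. externals D = X}"
    then have sub: "D \<subseteq> qedges G" and DX: "externals D = X" by (auto simp: dimers_def)
    note dec = dimer_eq_externals_Un_quadrangles[OF sub, unfolded DX]
    show "glue (\<lambda>e\<in>?E. D \<inter> quadrangle e) = D"
      using dec by (simp add: glue_def)
    show "(\<lambda>e\<in>?E. D \<inter> quadrangle e) \<in> Pi\<^sub>E ?E ?C"
      using D by (auto simp: dimers_iff)
    have "dimer_weight M J D = (\<Prod>x\<in>External ` X. qweight M J x) *
        (\<Prod>x\<in>(\<Union>e\<in>?E. D \<inter> quadrangle e). qweight M J x)"
      unfolding dimer_weight_def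
    proof (subst dec, rule prod.union_disjoint)
      show "finite (External ` X)" using X finite_arc_set by (auto dest: finite_subset)
      show "finite (\<Union>e\<in>?E. D \<inter> quadrangle e)" using finite_edges finite_quadrangle by auto
    qed (auto simp: quadrangle_def)
    also have "(\<Prod>x\<in>External ` X. qweight M J x) = 1" by (rule prod.neutral) auto
    also have "(\<Prod>x\<in>(\<Union>e\<in>?E. D \<inter> quadrangle e). qweight M J x) =
        (\<Prod>e\<in>?E. \<Prod>x\<in>D \<inter> quadrangle e. qweight M J x)"
    proof (rule prod.UNION_disjoint)
      show "\<forall>e\<in>?E. \<forall>e'\<in>?E. e \<noteq> e' \<longrightarrow>
          (D \<inter> quadrangle e) \<inter> (D \<inter> quadrangle e') = {}"
        using quadrangle_disjoint by blast
    qed (use finite_edges finite_quadrangle in auto)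
    finally show "(\<Prod>e\<in>?E. \<Prod>x\<in>(\<lambda>e\<in>?E. D \<inter> quadrangle e) e. qweight M J x) = dimer_weight M J D"
      by simp
  next
    fix g assume g: "g \<in> Pi\<^sub>E ?E ?C"
    show "(\<lambda>e\<in>?E. glue g \<inter> quadrangle e) = g"
      using loc[OF g] PiE_arb[OF g] by (auto simp: fun_eq_iff)
    have "g e \<subseteq> quadrangle e" if "e \<in> ?E" for e
      using PiE_mem[OF g that] completions_subset by blast
    then have "glue g \<subseteq> qedges G" unfolding glue_def qedges_eq using X by blast
    moreover have "\<forall>e\<in>?E. glue g \<inter> quadrangle e \<in> completions M (externals (glue g)) e"
      using loc[OF g] PiE_mem[OF g] ext[OF g] by simp
    ultimately show "glue g \<in> {D \<in> dimers G M. externals D = X}"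
      using ext[OF g] by (simp add: dimers_iff)
  qed
  also have "\<dots> = (\<Prod>e\<in>?E. \<Sum>N\<in>?C e. \<Prod>x\<in>N. qweight M J x)"
    by (rule prod_sum_PiE[OF finite_edges fin, symmetric])
  finally show ?thesis .
qed

text \<open>
  Every labelling with walls \<open>(P, Q)\<close> contributes the same amount.
\<close>

lemma W_quadri_eq_card_patterns:
  assumes PQ: "P \<subseteq> edges G M" "Q \<subseteq> edges G M" and disj: "P \<inter> Q = {}"
  shows "W_quadri G M J (P, Q) =
    real (card (patterns P Q)) * (\<Prod>e\<in>P. primal_weight J e) * (\<Prod>e\<in>Q. dual_weight J e)"
proof -
  let ?E = "edges G M"
  let ?w = "\<lambda>e. if e \<in> P then primal_weight J e else if e \<in> Q then dual_weight J e else 1"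
  have fin: "finite (patterns P Q)"
    by (rule finite_subset[of _ "Pow (arcs G)"]) (auto simp: patterns_def finite_arc_set)
  have "W_quadri G M J (P, Q) =
      (\<Sum>D\<in>{D \<in> dimers G M. externals D \<in> patterns P Q}. dimer_weight M J D)"
    unfolding W_quadri_def by (rule sum.cong) (use Poly_eq_iff[OF _ PQ] in auto)
  also have "\<dots> = (\<Sum>X\<in>patterns P Q. \<Sum>D\<in>{D \<in> {D \<in> dimers G M. externals D \<in> patterns P Q}. externals D = X}. dimer_weight M J D)"
    by (rule sum.group[symmetric]) (use finite_dimers fin in auto)
  also have "\<dots> = (\<Sum>X\<in>patterns P Q. \<Prod>e\<in>?E. ?w e)"
  proof (rule sum.cong[OF refl])
    fix X assume X: "X \<in> patterns P Q"
    have "{D \<in> {D \<in> dimers G M. externals D \<in> patterns P Q}. externals D = X} =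
        {D \<in> dimers G M. externals D = X}" using X by auto
    then have "(\<Sum>D\<in>{D \<in> {D \<in> dimers G M. externals D \<in> patterns P Q}. externals D = X}. dimer_weight M J D)
        = (\<Prod>e\<in>?E. \<Sum>N\<in>completions M X e. \<Prod>x\<in>N. qweight M J x)"
      using sum_dimers_with_externals[of X J] X by (simp add: patterns_def)
    also have "\<dots> = (\<Prod>e\<in>?E. ?w e)"
      by (rule prod.cong[OF refl]) (rule sum_completions[OF X disj])
    finally show "(\<Sum>D\<in>{D \<in> {D \<in> dimers G M. externals D \<in> patterns P Q}. externals D = X}. dimer_weight M J D)
        = (\<Prod>e\<in>?E. ?w e)" .
  qed
  also have "\<dots> = real (card (patterns P Q)) * (\<Prod>e\<in>?E. ?w e)" by simp
  also have "(\<Prod>e\<in>?E. ?w e) = (\<Prod>e\<in>P \<union> Q. ?w e)"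
    by (rule prod.mono_neutral_right) (use PQ finite_edges in auto)
  also have "\<dots> = (\<Prod>e\<in>P. ?w e) * (\<Prod>e\<in>Q. ?w e)"
    by (rule prod.union_disjoint) (use PQ finite_edges disj in \<open>auto dest: finite_subset\<close>)
  also have "(\<Prod>e\<in>P. ?w e) = (\<Prod>e\<in>P. primal_weight J e)" by simp
  also have "(\<Prod>e\<in>Q. ?w e) = (\<Prod>e\<in>Q. dual_weight J e)"
    by (rule prod.cong) (use disj in auto)
  finally show ?thesis by (simp add: mult.assoc)
qed

end

section \<open>Counting labellings by homology\<close>

context cellular_embedding
begin

text \<open>
  Existence of a labelling. The step \<open>pred\<close> stays at the same vertex, so only \<open>f\<close> can change, and
  \<open>face_succ\<close> stays at the same face, so only \<open>g\<close> can change.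
\<close>

lemma patterns_of_potentials:
  assumes f: "potential (face_succ M) f P" and g: "potential (edge_succ M) g Q"
  shows "{a \<in> arcs G. f a \<noteq> g a} \<in> patterns P Q"
  unfolding patterns_def
proof (intro CollectI conjI ballI)
  fix a assume a: "a \<in> arcs G"
  have gp: "g (pred a) = g a"
    using potential_step[OF g, of "pred a"] a by (simp add: succ_pred)
  have fp: "f (pred a) = f (edge_rev M a)"
    using potential_step[OF f, of "edge_rev M a"] a by (simp add: face_succ_eq rev_rev)
  show "(arc_edge M a \<in> P) =
      ((a \<in> {a \<in> arcs G. f a \<noteq> g a}) \<noteq> (pred a \<in> {a \<in> arcs G. f a \<noteq> g a}))"
    using potential_edge[OF f a] a by (simp add: gp fp) blast
  have ff: "f (face_succ M a) = f a"
    using potential_step[OF f a] .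
  have gf: "g (face_succ M a) = g (edge_rev M a)"
    using potential_step[OF g, of "face_succ M a"] a by (simp add: face_succ_eq succ_pred)
  show "(arc_edge M a \<in> Q) =
      ((a \<in> {a \<in> arcs G. f a \<noteq> g a}) \<noteq> (face_succ M a \<in> {a \<in> arcs G. f a \<noteq> g a}))"
    using potential_edge[OF g a] a by (simp add: ff gf) blast
qed auto

text \<open>
  Along each step both labellings change or both do not, so the set where they agree is closed under
  all steps.
\<close>

lemma patterns_equal_or_complement:
  assumes X: "X \<in> patterns P Q" and Y: "Y \<in> patterns P Q"
  shows "Y = X \<or> Y = arcs G - X"
proof -
  have sub: "X \<subseteq> arcs G" "Y \<subseteq> arcs G" using X Y by (auto simp: patterns_def)
  define S where "S = {a \<in> arcs G. (a \<in> X) = (a \<in> Y)}"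
  have step: "edge_succ M a \<in> S \<longleftrightarrow> a \<in> S" "edge_rev M a \<in> S \<longleftrightarrow> a \<in> S" if a: "a \<in> arcs G" for a
  proof -
    have pred: "pred b \<in> S \<longleftrightarrow> b \<in> S" if b: "b \<in> arcs G" for b
      using patterns_primal[OF X b] patterns_primal[OF Y b] b unfolding S_def by simp blast
    show succ: "edge_succ M a \<in> S \<longleftrightarrow> a \<in> S"
      using pred[of "edge_succ M a"] a by (simp add: succ_pred)
    have "pred (edge_rev M a) \<in> S \<longleftrightarrow> a \<in> S"
      using patterns_dual[OF X a] patterns_dual[OF Y a] a unfolding S_def by simp blast
    then show "edge_rev M a \<in> S \<longleftrightarrow> a \<in> S"
      using pred[of "edge_rev M a"] a by simp
  qed
  show ?thesis
  proof (cases "S = {}")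
    case True
    then have "\<forall>a\<in>arcs G. (a \<in> X) \<noteq> (a \<in> Y)" by (auto simp: S_def)
    then show ?thesis using sub by blast
  next
    case False
    have sub_arcs: "S \<subseteq> arcs G" by (auto simp: S_def)
    have "S = arcs G"
    proof (rule arcs_connected[OF sub_arcs False])
      fix a assume a: "a \<in> S"
      then have "a \<in> arcs G" using sub_arcs by blast
      from step[OF this] a show "edge_succ M a \<in> S" "edge_rev M a \<in> S" by simp_all
    qed
    then have "\<forall>a\<in>arcs G. (a \<in> X) = (a \<in> Y)" by (auto simp: S_def)
    then show ?thesis using sub by blast
  qed
qed

lemma complement_in_patterns:
  assumes X: "X \<in> patterns P Q"
  shows "arcs G - X \<in> patterns P Q"
  using X unfolding patterns_def by auto

lemma card_patterns:
  assumes "arcs G \<noteq> {}" and P: "P \<in> boundaries G M"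
    and Q: "Q \<in> boundaries (dual_graph G M) (dual_rotation M)"
  shows "card (patterns P Q) = 2"
proof -
  obtain f g where "potential (face_succ M) f P" "potential (edge_succ M) g Q"
    using P Q unfolding boundaries_iff dual_boundaries_iff by blast
  then have X: "{a \<in> arcs G. f a \<noteq> g a} \<in> patterns P Q" (is "?X \<in> _")
    by (rule patterns_of_potentials)
  have "patterns P Q = {?X, arcs G - ?X}"
    using X complement_in_patterns[OF X] patterns_equal_or_complement[OF X] by blast
  moreover have "?X \<noteq> arcs G - ?X" using assms(1) by blast
  ultimately show ?thesis by simp
qed

text \<open>
  The labelling changes evenly around every face, so \<open>Poly2\<close> is a polygon configuration of the
  dual. Its homology class vanishes because adding the potential of \<open>Poly1\<close> to the labelling removes
  all changes around the vertices and leaves those along the edges of \<open>Poly2\<close>.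
\<close>

lemma Poly2_in_dual_polygon_configs0:
  assumes D: "D \<in> dimers G M" and P: "Poly1 G M D \<in> boundaries G M"
  shows "Poly2 G M D \<in> polygon_configs0 (dual_graph G M) (dual_rotation M)"
proof -
  interpret dual: rotation_system "dual_graph G M" "dual_rotation M"
    by (rule dual_rotation_system)
  define X where "X = externals D"
  \<comment> \<open>Every dimer configuration is a labelling with its own walls.\<close>
  have X: "X \<in> patterns (Poly1 G M D) (Poly2 G M D)"
    unfolding X_def using Poly_eq_iff[OF D Poly_subset, of D D] by (simp add: Poly_def)
  have dual_arc_edge: "arc_edge (dual_rotation M) = arc_edge M"
    by (simp add: fun_eq_iff arc_edge_def dual_rotation_def)
  have "even (degree_in (dual_graph G M) (dual_rotation M) (Poly2 G M D) F)"
    if F: "F \<in> faces G M" for F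
  proof -
    define S where "S = {a \<in> arcs G. left_face M a = F}"
    have finS: "finite S" using finite_arc_set by (simp add: S_def)
    have "face_succ M ` S \<subseteq> S" by (auto simp: S_def)
    moreover have "inj_on (face_succ M) S"
      using permutes_inj[OF face_succ_permutes] by (rule inj_on_subset) simp
    ultimately have "bij_betw (face_succ M) S S"
      using finS by (simp add: bij_betw_def endo_inj_surj)
    then have "even (card {a \<in> S. (a \<in> X) \<noteq> (face_succ M a \<in> X)})"
      by (rule even_card_changes[OF finS])
    also have "{a \<in> S. (a \<in> X) \<noteq> (face_succ M a \<in> X)} = {a \<in> S. arc_edge M a \<in> Poly2 G M D}"
      using X unfolding patterns_def S_def by blast
    also have "S = out_arcs (dual_graph G M) F"
      by (auto simp: S_def out_arcs_def dual_graph_def)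
    finally show ?thesis by (simp add: degree_in_def dual_arc_edge)
  qed
  then have config: "Poly2 G M D \<in> polygon_configs (dual_graph G M) (dual_rotation M)"
    using Poly_subset(2)[of D] by (simp add: polygon_configs_def) (simp add: dual_graph_def)
  obtain f where f: "potential (face_succ M) f (Poly1 G M D)"
    using P by (auto simp: boundaries_iff)
  \<comment> \<open>Inequality of truth values is addition modulo 2.\<close>
  have "potential (edge_succ M) (\<lambda>a. f a \<noteq> (a \<in> X)) (Poly2 G M D)"
    unfolding potential_def
  proof (intro ballI conjI)
    have pred_inv: "(f (pred b) \<noteq> (pred b \<in> X)) = (f b \<noteq> (b \<in> X))" if b: "b \<in> arcs G" for b
    proof -
      have "f (pred b) = f (edge_rev M b)"
        using potential_step[OF f, of "edge_rev M b"] b by (simp add: face_succ_eq rev_rev)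
      then show ?thesis
        using potential_edge[OF f b] patterns_primal[OF X b] by argo
    qed
    fix a assume a: "a \<in> arcs G"
    show "(f (edge_succ M a) \<noteq> (edge_succ M a \<in> X)) = (f a \<noteq> (a \<in> X))"
      using pred_inv[of "edge_succ M a"] a by (simp add: succ_pred)
    have "f (pred (edge_rev M a)) = f a"
      using potential_step[OF f a] by (simp add: face_succ_eq)
    then show "(arc_edge M a \<in> Poly2 G M D) =
        ((f a \<noteq> (a \<in> X)) \<noteq> (f (edge_rev M a) \<noteq> (edge_rev M a \<in> X)))"
      using pred_inv[of "edge_rev M a"] patterns_dual[OF X a] a by simp argo
  qed
  then have "Poly2 G M D \<in> boundaries (dual_graph G M) (dual_rotation M)"
    using Poly_subset(2) by (auto simp: dual_boundaries_iff)
  with config show ?thesis by (simp add: dual.polygon_configs0_iff)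
qed

lemma dual_polygon_configs0_boundary:
  "Q \<in> polygon_configs0 (dual_graph G M) (dual_rotation M) \<Longrightarrow>
     Q \<in> boundaries (dual_graph G M) (dual_rotation M)"
  using rotation_system.polygon_configs0_iff[OF dual_rotation_system] by blast

lemma polygon_configs0_subset_edges:
  "P \<in> polygon_configs0 G M \<Longrightarrow> P \<subseteq> edges G M"
  "Q \<in> polygon_configs0 (dual_graph G M) (dual_rotation M) \<Longrightarrow> Q \<subseteq> edges G M"
  using dual_polygon_configs0_boundary[of Q]
  by (simp_all add: polygon_configs0_iff boundaries_iff dual_boundaries_iff)

lemma W_quadri_eq:
  assumes "arcs G \<noteq> {}" and P: "P \<in> polygon_configs0 G M"
    and Q: "Q \<in> polygon_configs0 (dual_graph G M) (dual_rotation M)" and "P \<inter> Q = {}"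
  shows "W_quadri G M J (P, Q) = 2 * (\<Prod>e\<in>P. primal_weight J e) * (\<Prod>e\<in>Q. dual_weight J e)"
proof -
  have b: "P \<in> boundaries G M" "Q \<in> boundaries (dual_graph G M) (dual_rotation M)"
    using P dual_polygon_configs0_boundary[OF Q] by (simp_all add: polygon_configs0_iff)
  have "P \<subseteq> edges G M" "Q \<subseteq> edges G M"
    using P Q by (simp_all add: polygon_configs0_subset_edges)
  then show ?thesis
    using W_quadri_eq_card_patterns[of P Q J] card_patterns[OF assms(1) b] assms(4) by simp
qed

text \<open>
  This makes the fibres of \<open>Poly\<close> over \<open>polygon_pairs0\<close> exhaust \<open>dimers0\<close>, although the definition
  of \<open>dimers0\<close> constrains only \<open>Poly1\<close>.
\<close>

lemma Poly_in_polygon_pairs0: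
  assumes "D \<in> dimers0 G M"
  shows "Poly G M D \<in> polygon_pairs0 G M"
  using assms Poly2_in_dual_polygon_configs0[of D] Poly_disjoint[of D]
  by (auto simp: dimers0_def polygon_pairs0_def Poly_def polygon_configs0_iff)

lemma finite_polygon_configs0:
  "finite (polygon_configs0 G M)" "finite (polygon_configs0 (dual_graph G M) (dual_rotation M))"
proof -
  have "polygon_configs0 G M \<subseteq> Pow (edges G M)"
    "polygon_configs0 (dual_graph G M) (dual_rotation M) \<subseteq> Pow (edges G M)"
    using polygon_configs0_subset_edges by blast+
  then show "finite (polygon_configs0 G M)"
    "finite (polygon_configs0 (dual_graph G M) (dual_rotation M))"
    using finite_edges by (auto dest: finite_subset)
qed

lemma sum_dimers0_Poly1:
  assumes "P \<in> polygon_configs0 G M"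
  shows "(\<Sum>D\<in>{D \<in> dimers0 G M. Poly1 G M D = P}. dimer_weight M J D) =
    (\<Sum>Q\<in>{Q \<in> polygon_configs0 (dual_graph G M) (dual_rotation M). P \<inter> Q = {}}.
       W_quadri G M J (P, Q))"
proof -
  let ?T = "{Q \<in> polygon_configs0 (dual_graph G M) (dual_rotation M). P \<inter> Q = {}}"
  let ?S = "{D \<in> dimers0 G M. Poly1 G M D = P}"
  have "finite ?S" "finite ?T"
    using finite_dimers finite_polygon_configs0(2) by (auto simp: dimers0_def)
  moreover have "Poly2 G M ` ?S \<subseteq> ?T"
    using Poly_in_polygon_pairs0 by (fastforce simp: polygon_pairs0_def Poly_def)
  ultimately have "(\<Sum>D\<in>?S. dimer_weight M J D) =
      (\<Sum>Q\<in>?T. \<Sum>D\<in>{D \<in> ?S. Poly2 G M D = Q}. dimer_weight M J D)"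
    by (intro sum.group[symmetric])
  moreover have "{D \<in> ?S. Poly2 G M D = Q} = {D \<in> dimers G M. Poly G M D = (P, Q)}" for Q
    using assms by (auto simp: dimers0_def Poly_def)
  ultimately show ?thesis by (simp only: W_quadri_def)
qed

lemma Z0_quadri_eq_sum:
  "Z0_quadri G M J = (\<Sum>(P, Q)\<in>polygon_pairs0 G M. W_quadri G M J (P, Q))"
proof -
  let ?T = "\<lambda>P. {Q \<in> polygon_configs0 (dual_graph G M) (dual_rotation M). P \<inter> Q = {}}"
  have "Z0_quadri G M J =
      (\<Sum>P\<in>polygon_configs0 G M. \<Sum>D\<in>{D \<in> dimers0 G M. Poly1 G M D = P}. dimer_weight M J D)"
    unfolding Z0_quadri_def
    by (rule sum.group[symmetric])
       (use finite_dimers finite_polygon_configs0(1) in \<open>auto simp: dimers0_def\<close>)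
  also have "\<dots> = (\<Sum>P\<in>polygon_configs0 G M. \<Sum>Q\<in>?T P. W_quadri G M J (P, Q))"
    by (rule sum.cong[OF refl sum_dimers0_Poly1])
  also have "\<dots> = (\<Sum>(P, Q)\<in>Sigma (polygon_configs0 G M) ?T. W_quadri G M J (P, Q))"
    by (rule sum.Sigma) (use finite_polygon_configs0 in auto)
  also have "Sigma (polygon_configs0 G M) ?T = polygon_pairs0 G M"
    by (auto simp: polygon_pairs0_def)
  finally show ?thesis .
qed

lemma Z0_quadri_eq:
  assumes "arcs G \<noteq> {}"
  shows "Z0_quadri G M J = 2 * (\<Sum>(P, Q)\<in>polygon_pairs0 G M.
           (\<Prod>e\<in>P. primal_weight J e) * (\<Prod>e\<in>Q. dual_weight J e))"
  unfolding Z0_quadri_eq_sum sum_distrib_left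
  by (rule sum.cong) (auto simp: polygon_pairs0_def W_quadri_eq[OF assms] mult.assoc)

text \<open>The pair with no edges gives the partition function a positive term.\<close>

lemma empty_in_polygon_pairs0: "({}, {}) \<in> polygon_pairs0 G M"
proof -
  interpret dual: rotation_system "dual_graph G M" "dual_rotation M"
    by (rule dual_rotation_system)
  show ?thesis
    by (auto simp: polygon_pairs0_def polygon_configs0_iff dual.polygon_configs0_iff
        polygon_configs_def degree_in_def empty_in_boundaries dual.empty_in_boundaries)
qed

lemma finite_polygon_pairs0: "finite (polygon_pairs0 G M)"
  by (rule finite_subset[OF _ finite_cartesian_product[OF finite_polygon_configs0]])
     (auto simp: polygon_pairs0_def)

end

section \<open>The probability measure\<close>

lemma primal_weight_pos: "primal_weight J e > 0"
  unfolding primal_weight_def by (intro divide_pos_pos add_pos_pos) auto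

lemma dual_weight_pos: "J e > 0 \<Longrightarrow> dual_weight J e > 0"
  unfolding dual_weight_def by (intro divide_pos_pos add_pos_pos) auto

context cellular_embedding
begin

lemma Z0_quadri_pos:
  assumes "arcs G \<noteq> {}" and J: "\<And>e. e \<in> edges G M \<Longrightarrow> J e > 0"
  shows "Z0_quadri G M J > 0"
proof -
  have "(\<Prod>e\<in>P. primal_weight J e) * (\<Prod>e\<in>Q. dual_weight J e) > 0"
    if "(P, Q) \<in> polygon_pairs0 G M" for P Q
  proof (intro mult_pos_pos prod_pos primal_weight_pos dual_weight_pos J)
    fix e assume "e \<in> Q"
    then show "e \<in> edges G M"
      using that polygon_configs0_subset_edges(2)[of Q] by (auto simp: polygon_pairs0_def)
  qed
  then have "(\<Sum>(P, Q)\<in>polygon_pairs0 G M.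
      (\<Prod>e\<in>P. primal_weight J e) * (\<Prod>e\<in>Q. dual_weight J e)) > 0"
    using finite_polygon_pairs0 empty_in_polygon_pairs0 by (intro sum_pos) auto
  then show ?thesis unfolding Z0_quadri_eq[OF assms(1)] by simp
qed

lemma dimer_weight_nonneg:
  assumes J: "\<And>e. e \<in> edges G M \<Longrightarrow> J e > 0" and D: "D \<in> dimers G M"
  shows "dimer_weight M J D \<ge> 0"
  unfolding dimer_weight_def
proof (rule prod_nonneg)
  fix x assume "x \<in> D"
  then have x: "x \<in> qedges G" using D by (auto simp: dimers_def)
  have pos: "0 \<le> dual_weight J (arc_edge M a)" if "a \<in> arcs G" for a
    using dual_weight_pos[of J "arc_edge M a"] J[OF arc_edge_in_edges[OF that]] by simp
  from x consider a where "x = External a" | a where "x = ParPrimal a"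
    | a where "x = ParDual a" "a \<in> arcs G" by (auto simp: qedges_def)
  then show "0 \<le> qweight M J x"
  proof cases
    case 2
    then show ?thesis
      using primal_weight_pos[of J "arc_edge M a"] by (simp add: primal_weight_def)
  next
    case 3
    then show ?thesis using pos[of a] by (simp add: dual_weight_def)
  qed simp
qed

lemma prob_space_P0_quadri:
  assumes "arcs G \<noteq> {}" and J: "\<And>e. e \<in> edges G M \<Longrightarrow> J e > 0"
  shows "prob_space (P0_quadri G M J)"
  unfolding P0_quadri_def
proof (rule prob_space_point_measure)
  have Z: "Z0_quadri G M J > 0" by (rule Z0_quadri_pos[OF assms])
  have nn: "dimer_weight M J D / Z0_quadri G M J \<ge> 0" if "D \<in> dimers0 G M" for D
    using dimer_weight_nonneg[OF J, where D = D] that Z by (simp add: dimers0_def)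
  have "(\<Sum>D\<in>dimers0 G M. dimer_weight M J D / Z0_quadri G M J) = 1"
    using Z by (simp add: Z0_quadri_def flip: sum_divide_distrib)
  then show "(\<Sum>D\<in>dimers0 G M. ennreal (dimer_weight M J D / Z0_quadri G M J)) = 1"
    by (subst sum_ennreal) (auto simp: nn)
qed (use finite_dimers in \<open>auto simp: dimers0_def\<close>)

lemma measure_P0_quadri:
  assumes "arcs G \<noteq> {}" and J: "\<And>e. e \<in> edges G M \<Longrightarrow> J e > 0" and S: "S \<subseteq> dimers0 G M"
  shows "measure (P0_quadri G M J) S = (\<Sum>D\<in>S. dimer_weight M J D) / Z0_quadri G M J"
proof -
  have Z: "Z0_quadri G M J > 0" by (rule Z0_quadri_pos[OF assms(1,2)])
  have nn: "dimer_weight M J D / Z0_quadri G M J \<ge> 0" if "D \<in> S" for D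
    using dimer_weight_nonneg[OF J, where D = D] that S Z by (auto simp: dimers0_def)
  have "finite (dimers0 G M)" using finite_dimers by (simp add: dimers0_def)
  then have "emeasure (P0_quadri G M J) S =
      (\<Sum>D\<in>S. ennreal (dimer_weight M J D / Z0_quadri G M J))"
    unfolding P0_quadri_def using S by (rule emeasure_point_measure_finite)
  also have "\<dots> = ennreal (\<Sum>D\<in>S. dimer_weight M J D / Z0_quadri G M J)"
    by (rule sum_ennreal) (rule nn)
  finally show ?thesis
    using sum_nonneg[of S, OF nn] by (simp add: measure_def sum_divide_distrib)
qed

lemma measure_Poly1:
  assumes "arcs G \<noteq> {}" and J: "\<And>e. e \<in> edges G M \<Longrightarrow> J e > 0" and P: "P \<in> polygon_configs0 G M"
  shows "measure (P0_quadri G M J) {D \<in> space (P0_quadri G M J). Poly1 G M D = P} =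
    (\<Prod>e\<in>P. primal_weight J e) *
    (\<Sum>Q\<in>{Q \<in> polygon_configs0 (dual_graph G M) (dual_rotation M). P \<inter> Q = {}}.
       \<Prod>e\<in>Q. dual_weight J e) /
    (\<Sum>(R, S)\<in>polygon_pairs0 G M. (\<Prod>e\<in>R. primal_weight J e) * (\<Prod>e\<in>S. dual_weight J e))"
proof -
  let ?T = "{Q \<in> polygon_configs0 (dual_graph G M) (dual_rotation M). P \<inter> Q = {}}"
  have "{D \<in> space (P0_quadri G M J). Poly1 G M D = P} = {D \<in> dimers0 G M. Poly1 G M D = P}"
    by (simp add: P0_quadri_def space_point_measure)
  then have "measure (P0_quadri G M J) {D \<in> space (P0_quadri G M J). Poly1 G M D = P} =
      (\<Sum>Q\<in>?T. W_quadri G M J (P, Q)) / Z0_quadri G M J"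
    using measure_P0_quadri[OF assms(1) J, where S = "{D \<in> dimers0 G M. Poly1 G M D = P}"]
    by (simp add: sum_dimers0_Poly1[OF P])
  also have "(\<Sum>Q\<in>?T. W_quadri G M J (P, Q)) =
      2 * ((\<Prod>e\<in>P. primal_weight J e) * (\<Sum>Q\<in>?T. \<Prod>e\<in>Q. dual_weight J e))"
    unfolding sum_distrib_left
    by (rule sum.cong) (auto simp: W_quadri_eq[OF assms(1) P] mult.assoc)
  finally show ?thesis by (simp only: Z0_quadri_eq[OF assms(1)])
qed

end

theorem proposition18:
  fixes G :: "('v, 'a) pre_digraph" and M :: "'a rotation" and J :: "'a set \<Rightarrow> real"
  assumes "cellular_embedding G M"
    and "arcs G \<noteq> {}"
    and "\<And>e. e \<in> edges (dual_graph G M) (dual_rotation M) \<Longrightarrow> J e > 0"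
  shows "(\<forall>P\<in>polygon_configs0 G M. \<forall>Q\<in>polygon_configs0 (dual_graph G M) (dual_rotation M).
           P \<inter> Q = {} \<longrightarrow>
           W_quadri G M J (P, Q) =
             2 * (\<Prod>e\<in>P. 2 * exp (- 2 * J e) / (1 + exp (- 4 * J e))) *
                 (\<Prod>e\<in>Q. (1 - exp (- 4 * J e)) / (1 + exp (- 4 * J e))))
    \<and> (Z0_quadri G M J =
           2 * (\<Sum>(P, Q)\<in>polygon_pairs0 G M.
                  (\<Prod>e\<in>P. 2 * exp (- 2 * J e) / (1 + exp (- 4 * J e))) *
                  (\<Prod>e\<in>Q. (1 - exp (- 4 * J e)) / (1 + exp (- 4 * J e)))))
    \<and> (prob_space (P0_quadri G M J))
    \<and> (Poly1 G M \<in> measurable (P0_quadri G M J) (count_space (polygon_configs0 G M)))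
    \<and> (prob_space (distr (P0_quadri G M J) (count_space (polygon_configs0 G M)) (Poly1 G M)))
    \<and> (\<forall>P\<in>polygon_configs0 G M.
           measure (P0_quadri G M J) {D \<in> space (P0_quadri G M J). Poly1 G M D = P} =
             (\<Prod>e\<in>P. 2 * exp (- 2 * J e) / (1 + exp (- 4 * J e))) *
             (\<Sum>Q\<in>{Q \<in> polygon_configs0 (dual_graph G M) (dual_rotation M). P \<inter> Q = {}}.
                \<Prod>e\<in>Q. (1 - exp (- 4 * J e)) / (1 + exp (- 4 * J e))) /
             (\<Sum>(R, S)\<in>polygon_pairs0 G M.
                (\<Prod>e\<in>R. 2 * exp (- 2 * J e) / (1 + exp (- 4 * J e))) *
                (\<Prod>e\<in>S. (1 - exp (- 4 * J e)) / (1 + exp (- 4 * J e)))))"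
proof -
  interpret cellular_embedding G M by (rule assms(1))
  note ne = assms(2)
  have J: "J e > 0" if "e \<in> edges G M" for e using assms(3) that by simp
  have prob: "prob_space (P0_quadri G M J)"
    by (rule prob_space_P0_quadri[OF ne J])
  have meas: "Poly1 G M \<in> measurable (P0_quadri G M J) (count_space (polygon_configs0 G M))"
    by (auto simp: P0_quadri_def measurable_def space_point_measure sets_point_measure dimers0_def)
  have distr: "prob_space (distr (P0_quadri G M J) (count_space (polygon_configs0 G M)) (Poly1 G M))"
    by (rule prob_space.prob_space_distr[OF prob meas])
  show ?thesis
    unfolding primal_weight_def[symmetric] dual_weight_def[symmetric]
    by (intro conjI ballI impI W_quadri_eq[OF ne] Z0_quadri_eq[OF ne] prob meas distr
        measure_Poly1[OF ne J])
qed

end
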